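(* There exist positive numerical constants $c,C,n_0$ such that the following holds. Assume that $K\ge 2$, $n\geq 9K/2$, $\alpha\geq\frac32$ and $n\geq n_0$, and let $p\ge 1$, $\sigma>0$, $\bar\Delta>0$. If $$\bar\Delta^{2}\leq c\left(\log(n)\vee\sqrt{\frac{pK\log(n)}{n}}\right),$$ then, for any estimator $\hat G$ (a measurable map from the observations $(Y_1,\ldots,Y_n)$ to partitions of $\{1,\ldots,n\}$ into $K$ groups), $$\sup_{G\in\mathcal{P}_\alpha}\ \sup_{\mu\in\Theta_{\bar\Delta}}\mathbb{P}_{\mu,G}\left[\hat G\neq G\right]>C.$$
   Context: $\mathcal{P}_\alpha$ is the set of partitions $G=\{G_1,\ldots,G_K\}$ of $\{1,\ldots,n\}$ into $K$ (nonempty, numbered) groups such that $\max_k|G_k|/\min_k|G_k|\leq\alpha$. $\Theta_{\bar\Delta}$ is the set of $K$-tuples $\mu=(\mu_1,\ldots,\mu_K)\in(\mathbb{R}^p)^K$ such that $\min_{l\neq r}\frac{\|\mu_r-\mu_l\|^2}{2\sigma^2}\geq\bar\Delta^2$. For $\mu\in(\mathbb{R}^p)^K$ and a partition $G$, $\mathbb{P}_{\mu,G}$ is the law of $(Y_1,\ldots,Y_n)\in(\mathbb{R}^p)^n$ where the $Y_i$ are independent and $Y_i\sim\mathcal{N}(\mu_k,\sigma^2I_p)$ when $i\in G_k$. The event $\hat G\neq G$ means that $\hat G$ and $G$ differ as partitions, i.e. as unordered collections of groups (the numbering of the groups is irrelevant). Notation: $a\vee b=\max(a,b)$. *)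

theory Defs
  imports "HOL-Probability.Probability"
begin

text \<open>
  The constants of the lower bound must not depend on the dimension, so \<open>\<real>\<^sup>p\<close> cannot be a
  type: it is the set \<open>{1..p} \<rightarrow>\<^sub>E UNIV\<close>, with the product Borel sigma-algebra.
\<close>

text \<open>The numbering of the groups matters for the law of the observations only: the unordered
  partition underlying \<open>G\<close> is \<open>G ` {1..K}\<close>.\<close>

definition numbered_partitions :: "nat \<Rightarrow> nat \<Rightarrow> (nat \<Rightarrow> nat set) set" where
  "numbered_partitions n K =
     {G \<in> {1..K} \<rightarrow>\<^sub>E Pow {1..n}.
        (\<forall>k\<in>{1..K}. G k \<noteq> {}) \<and> disjoint_family_on G {1..K} \<and> (\<Union>k\<in>{1..K}. G k) = {1..n}}"

definition balanced_partitions :: "nat \<Rightarrow> nat \<Rightarrow> real \<Rightarrow> (nat \<Rightarrow> nat set) set" where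
  "balanced_partitions n K \<alpha> =
     {G \<in> numbered_partitions n K.
        real (MAX k\<in>{1..K}. card (G k)) / real (MIN k\<in>{1..K}. card (G k)) \<le> \<alpha>}"

text \<open>The minimum below ranges over a nonempty set only if \<open>K \<ge> 2\<close>.\<close>

definition separated_means :: "nat \<Rightarrow> nat \<Rightarrow> real \<Rightarrow> real \<Rightarrow> (nat \<Rightarrow> nat \<Rightarrow> real) set" where
  "separated_means K p \<sigma> \<Delta> =
     {\<mu> \<in> {1..K} \<rightarrow>\<^sub>E ({1..p} \<rightarrow>\<^sub>E UNIV).
        Min {(L2_set (\<lambda>j. \<mu> r j - \<mu> l j) {1..p})\<^sup>2 / (2 * \<sigma>\<^sup>2) | l r.
               l \<in> {1..K} \<and> r \<in> {1..K} \<and> l \<noteq> r} \<ge> \<Delta>\<^sup>2}"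

text \<open>The law \<open>N(m, \<sigma>\<^sup>2 I\<^sub>p)\<close>, whose coordinates are independent; the second parameter of
  \<^const>\<open>normal_density\<close> is the standard deviation.\<close>

definition isotropic_gaussian :: "nat \<Rightarrow> (nat \<Rightarrow> real) \<Rightarrow> real \<Rightarrow> (nat \<Rightarrow> real) measure" where
  "isotropic_gaussian p m \<sigma> =
     (\<Pi>\<^sub>M j\<in>{1..p}. density lborel (\<lambda>x. ennreal (normal_density (m j) \<sigma> x)))"

definition group_of :: "nat \<Rightarrow> (nat \<Rightarrow> nat set) \<Rightarrow> nat \<Rightarrow> nat" where
  "group_of K G i = (THE k. k \<in> {1..K} \<and> i \<in> G k)"

definition cluster_law ::
  "nat \<Rightarrow> nat \<Rightarrow> nat \<Rightarrow> real \<Rightarrow> (nat \<Rightarrow> nat \<Rightarrow> real) \<Rightarrow> (nat \<Rightarrow> nat set) \<Rightarrow> (nat \<Rightarrow> nat \<Rightarrow> real) measure"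
  where
  "cluster_law n K p \<sigma> \<mu> G =
     (\<Pi>\<^sub>M i\<in>{1..n}. isotropic_gaussian p (\<mu> (group_of K G i)) \<sigma>)"

definition estimators :: "nat \<Rightarrow> nat \<Rightarrow> nat \<Rightarrow> ((nat \<Rightarrow> nat \<Rightarrow> real) \<Rightarrow> nat set set) set" where
  "estimators n K p =
     (\<Pi>\<^sub>M i\<in>{1..n}. \<Pi>\<^sub>M j\<in>{1..p}. borel) \<rightarrow>\<^sub>M count_space {P. partition_on {1..n} P \<and> card P = K}"

end

theory Submission
  imports Defs
begin

text \<open>
  Label the observations by their residue modulo \<open>K\<close>, and compare this partition with the ones
  obtained from it by swapping two neighbours \<open>l\<close> and \<open>Suc l\<close>, for at least \<open>n/6\<close> values of \<open>l\<close>.  Swapping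
  keeps the group sizes, so all of these partitions are balanced.  An estimator whose error
  probability is small everywhere finds each swapped partition with large probability, on events
  \<open>A l\<close> that are pairwise disjoint.  If the law under one swap is close enough to the law under no
  swap, these disjoint events all have a substantial probability under no swap, which is impossible.

  The groups are paired up.  The two groups of pair \<open>b\<close> have the centers \<open>o\<^sub>b + \<sigma>\<epsilon>v\<^sub>b\<close> and
  \<open>o\<^sub>b - \<sigma>\<epsilon>v\<^sub>b\<close>, where \<open>v\<^sub>b\<close> is a vector of signs and the offsets \<open>o\<^sub>b\<close> lie far apart on the first
  axis.  So the centers are separated whatever the signs are, with \<open>\<epsilon>\<^sup>2 = \<Delta>\<^sup>2 / (2p)\<close>, and the signs can be
  averaged out uniformly: this is what makes the problem hard in high dimension, where the direction
  \<open>v\<^sub>b\<close> has to be learnt from the \<open>2n/K\<close> or so observations of the pair.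

  Closeness means the following.  If \<open>P\<close> and \<open>Q\<close> are the laws without and with the swap, averaged over
  the signs of the pair in question, with densities \<open>f\<close> and \<open>g\<close>, then
  \<open>g \<le> (\<tau>/2) f + g\<^sup>2 / (2\<tau>f)\<close> gives \<open>Q A \<le> (\<tau>/2) P A + \<chi> / (2\<tau>)\<close>, where \<open>\<chi>\<close> is the integral of \<open>g\<^sup>2/f\<close>
  (\<open>sign_mixture_comparison\<close>).  As this bound is linear, averaging over the signs of the other
  pairs and summing over \<open>l\<close> costs nothing.  With \<open>M\<close> swaps and \<open>\<tau> = M/2\<close>, the average success
  probability is at most \<open>1/4 + \<chi>/M\<close>.

  The average over signs factorises over the \<open>p\<close> coordinates, hence so does \<open>\<chi>\<close>.  In one coordinate the
  densities relative to the law without signal are proportional to \<open>cosh (a + x)\<close> and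
  \<open>cosh (a - x)\<close>, where \<open>x\<close> comes from the two swapped observations and \<open>a\<close> from the rest of the
  pair.  An elementary inequality (\<open>cosh_sq_over_cosh_le\<close>) bounds the square of
  the second divided by the first by
  exponentials of linear forms, whose Gaussian means are explicit, and \<open>\<chi>\<close> is at most
  \<open>(1 + 4 (1 - exp (-s/2)) (exp (8\<epsilon>\<^sup>2) - 1))\<^sup>p\<close> with \<open>s \<le> 4\<epsilon>\<^sup>2n/K\<close>.  Bounding the middle factor by \<open>1\<close>
  gives \<open>\<chi> \<le> exp (16\<Delta>\<^sup>2)\<close>, and bounding it by \<open>s/2\<close> gives \<open>\<chi> \<le> exp (32 \<Delta>\<^sup>4 n / (Kp))\<close> when \<open>8\<epsilon>\<^sup>2 \<le> 1\<close>.
  These are the two regimes of the theorem (\<open>second_moment_le_sqrt\<close>).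
\<close>

section \<open>Densities and columns of product measures\<close>

lemma PiM_density:
  fixes M :: "'i \<Rightarrow> 'a measure"
  assumes fin: "finite I"
    and sfM: "\<And>i. sigma_finite_measure (M i)"
    and sfD: "\<And>i. sigma_finite_measure (density (M i) (f i))"
    and f: "\<And>i. i \<in> I \<Longrightarrow> f i \<in> borel_measurable (M i)"
  shows "PiM I (\<lambda>i. density (M i) (f i)) = density (PiM I M) (\<lambda>x. \<Prod>i\<in>I. f i (x i))"
proof (rule sym, rule product_sigma_finite.PiM_eqI)
  interpret M: product_sigma_finite M
    by (rule product_sigma_finite.intro) (rule sfM)
  note f[measurable]
  show "product_sigma_finite (\<lambda>i. density (M i) (f i))"
    by (rule product_sigma_finite.intro) (rule sfD)
  show "finite I" by fact
  show "sets (density (PiM I M) (\<lambda>x. \<Prod>i\<in>I. f i (x i))) = sets (PiM I (\<lambda>i. density (M i) (f i)))"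
    by (simp cong: sets_PiM_cong)
  fix A assume A: "\<And>i. i \<in> I \<Longrightarrow> A i \<in> sets (density (M i) (f i))"
  then have A': "\<And>i. i \<in> I \<Longrightarrow> A i \<in> sets (M i)"
    by simp
  note A'[measurable]
  have "emeasure (density (PiM I M) (\<lambda>x. \<Prod>i\<in>I. f i (x i))) (Pi\<^sub>E I A)
      = (\<integral>\<^sup>+x. (\<Prod>i\<in>I. f i (x i)) * indicator (Pi\<^sub>E I A) x \<partial>PiM I M)"
    using fin A' by (intro emeasure_density) (auto intro!: sets_PiM_I_finite)
  also have "\<dots> = (\<integral>\<^sup>+x. (\<Prod>i\<in>I. f i (x i) * indicator (A i) (x i)) \<partial>PiM I M)"
  proof (rule nn_integral_cong)
    fix x assume "x \<in> space (PiM I M)"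
    then have x: "x \<in> extensional I"
      by (auto simp: space_PiM PiE_def)
    have "indicator (Pi\<^sub>E I A) x = (\<Prod>i\<in>I. indicator (A i) (x i) :: ennreal)"
    proof (cases "x \<in> Pi\<^sub>E I A")
      case True
      then show ?thesis by (auto simp: PiE_iff)
    next
      case False
      then obtain i where "i \<in> I" "x i \<notin> A i"
        using x by (auto simp: PiE_iff)
      then show ?thesis
        using False fin by (auto simp: indicator_def prod_zero_iff)
    qed
    then show "(\<Prod>i\<in>I. f i (x i)) * indicator (Pi\<^sub>E I A) x
        = (\<Prod>i\<in>I. f i (x i) * indicator (A i) (x i))"
      by (simp add: prod.distrib)
  qed
  also have "\<dots> = (\<Prod>i\<in>I. \<integral>\<^sup>+x. f i x * indicator (A i) x \<partial>M i)"
    by (intro M.product_nn_integral_prod fin) measurable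
  also have "\<dots> = (\<Prod>i\<in>I. emeasure (density (M i) (f i)) (A i))"
    by (intro prod.cong refl emeasure_density[symmetric] f A')
  finally show "emeasure (density (PiM I M) (\<lambda>x. \<Prod>i\<in>I. f i (x i))) (Pi\<^sub>E I A)
      = (\<Prod>i\<in>I. emeasure (density (M i) (f i)) (A i))" .
qed

lemma measurable_entry:
  assumes "i \<in> I" "j \<in> J"
  shows "(\<lambda>y. y i j) \<in> measurable (PiM I (\<lambda>i. PiM J (M i))) (M i j)"
proof -
  have row: "(\<lambda>y. y i) \<in> measurable (PiM I (\<lambda>i. PiM J (M i))) (PiM J (M i))"
    by (rule measurable_component_singleton) fact
  have entry: "(\<lambda>r. r j) \<in> measurable (PiM J (M i)) (M i j)"
    by (rule measurable_component_singleton) fact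
  from measurable_compose[OF row entry] show ?thesis .
qed

lemma measurable_column [measurable]:
  assumes "j \<in> J"
  shows "(\<lambda>y. \<lambda>i\<in>I. y i j) \<in> measurable (PiM I (\<lambda>i. PiM J (M i))) (PiM I (\<lambda>i. M i j))"
  by (intro measurable_restrict measurable_entry assms)

text \<open>
  Under a product of products the columns are independent.  Building up the rows one at a time
  avoids identifying the two ways of nesting the products: integrating out row \<open>i\<close> turns each column
  function into a function of a column that is one entry shorter.
\<close>

lemma nn_integral_PiM_prod_columns:
  fixes M :: "'i \<Rightarrow> 'j \<Rightarrow> 'a measure"
  assumes "finite I" "finite J"
    and sf: "\<And>i j. sigma_finite_measure (M i j)"
    and "\<And>j. j \<in> J \<Longrightarrow> F j \<in> borel_measurable (PiM I (\<lambda>i. M i j))"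
  shows "(\<integral>\<^sup>+y. (\<Prod>j\<in>J. F j (\<lambda>i\<in>I. y i j)) \<partial>PiM I (\<lambda>i. PiM J (M i)))
       = (\<Prod>j\<in>J. \<integral>\<^sup>+c. F j c \<partial>PiM I (\<lambda>i. M i j))"
  using assms(1,4)
proof (induction I arbitrary: F rule: finite_induct)
  case empty
  then show ?case
    by (simp add: PiM_empty nn_integral_count_space_finite restrict_def)
next
  case (insert i I)
  note insert.prems[measurable]
  have psf_row: "product_sigma_finite (M k)" for k
    by (rule product_sigma_finite.intro) (rule sf)
  have psf_col: "product_sigma_finite (\<lambda>k. M k j)" for j
    by (rule product_sigma_finite.intro) (rule sf)
  have psf: "product_sigma_finite (\<lambda>k. PiM J (M k))"
    by (auto simp: product_sigma_finite_def intro!: product_sigma_finite.sigma_finite psf_row assms)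
  have m2: "(\<lambda>(c, x). F j (c(i := x))) \<in> borel_measurable (PiM I (\<lambda>k. M k j) \<Otimes>\<^sub>M M i j)" if "j \<in> J" for j
  proof -
    have "(\<lambda>(c, x). c(i := x)) \<in> measurable (PiM I (\<lambda>k. M k j) \<Otimes>\<^sub>M M i j) (PiM (insert i I) (\<lambda>k. M k j))"
      by (rule measurable_add_dim)
    from measurable_compose[OF this insert.prems[OF that]] show ?thesis
      by (simp add: case_prod_beta' fun_upd_def)
  qed
  define F' where "F' j c = (\<integral>\<^sup>+x. F j (c(i := x)) \<partial>M i j)" for j c
  have F'_meas: "F' j \<in> borel_measurable (PiM I (\<lambda>k. M k j))" if "j \<in> J" for j
    unfolding F'_def
    by (rule sigma_finite_measure.borel_measurable_nn_integral[OF sf m2[OF that]])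
  have "(\<integral>\<^sup>+y. (\<Prod>j\<in>J. F j (\<lambda>k\<in>insert i I. y k j)) \<partial>PiM (insert i I) (\<lambda>k. PiM J (M k)))
      = (\<integral>\<^sup>+y. \<integral>\<^sup>+x. (\<Prod>j\<in>J. F j (\<lambda>k\<in>insert i I. (y(i := x)) k j)) \<partial>PiM J (M i)
           \<partial>PiM I (\<lambda>k. PiM J (M k)))"
    by (intro product_sigma_finite.product_nn_integral_insert psf insert.hyps borel_measurable_prod_ennreal
        measurable_compose[OF measurable_column insert.prems])
  also have "\<dots> = (\<integral>\<^sup>+y. \<integral>\<^sup>+x. (\<Prod>j\<in>J. F j ((\<lambda>k\<in>I. y k j)(i := x j))) \<partial>PiM J (M i)
           \<partial>PiM I (\<lambda>k. PiM J (M k)))"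
    using insert.hyps
    by (intro nn_integral_cong prod.cong arg_cong[where f = "F _"]) (auto simp: fun_eq_iff)
  also have "\<dots> = (\<integral>\<^sup>+y. (\<Prod>j\<in>J. F' j (\<lambda>k\<in>I. y k j)) \<partial>PiM I (\<lambda>k. PiM J (M k)))"
  proof (rule nn_integral_cong)
    fix y assume y: "y \<in> space (PiM I (\<lambda>k. PiM J (M k)))"
    have c: "(\<lambda>k\<in>I. y k j) \<in> space (PiM I (\<lambda>k. M k j))" if "j \<in> J" for j
      using y that by (auto simp: space_PiM PiE_iff)
    have "(\<lambda>x. F j ((\<lambda>k\<in>I. y k j)(i := x))) \<in> borel_measurable (M i j)" if "j \<in> J" for j
      using measurable_compose[OF measurable_Pair1'[OF c[OF that]] m2[OF that]] by simp
    then show "(\<integral>\<^sup>+x. (\<Prod>j\<in>J. F j ((\<lambda>k\<in>I. y k j)(i := x j))) \<partial>PiM J (M i))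
        = (\<Prod>j\<in>J. F' j (\<lambda>k\<in>I. y k j))"
      unfolding F'_def
      by (intro product_sigma_finite.product_nn_integral_prod[OF psf_row \<open>finite J\<close>, where f = "\<lambda>j x. F j ((\<lambda>k\<in>I. y k j)(i := x))"])
  qed
  also have "\<dots> = (\<Prod>j\<in>J. \<integral>\<^sup>+c. F' j c \<partial>PiM I (\<lambda>k. M k j))"
    by (intro insert.IH F'_meas)
  also have "\<dots> = (\<Prod>j\<in>J. \<integral>\<^sup>+c. F j c \<partial>PiM (insert i I) (\<lambda>k. M k j))"
    unfolding F'_def
    by (intro prod.cong refl product_sigma_finite.product_nn_integral_insert[symmetric] psf_col
        insert.hyps insert.prems)
  finally show ?case .
qed

section \<open>Arrays of independent Gaussians\<close>

lemma normal_density_shift: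
  assumes "\<sigma> > 0"
  shows "normal_density (m + \<sigma> * d) \<sigma> x = exp (d * ((x - m) / \<sigma>) - d\<^sup>2 / 2) * normal_density m \<sigma> x"
proof -
  have "- (x - (m + \<sigma> * d))\<^sup>2 / (2 * \<sigma>\<^sup>2) = d * ((x - m) / \<sigma>) - d\<^sup>2 / 2 - (x - m)\<^sup>2 / (2 * \<sigma>\<^sup>2)"
    using assms by (simp add: field_simps power2_eq_square)
  then show ?thesis
    by (simp add: normal_density_def flip: exp_add)
qed

abbreviation gaussian :: "real \<Rightarrow> real \<Rightarrow> real measure" where
  "gaussian m \<sigma> \<equiv> density lborel (\<lambda>x. ennreal (normal_density m \<sigma> x))"

lemma sigma_finite_gaussian: "\<sigma> > 0 \<Longrightarrow> sigma_finite_measure (gaussian m \<sigma>)"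
  using prob_space_normal_density prob_space_imp_sigma_finite by blast

lemma gaussian_shift:
  assumes "\<sigma> > 0"
  shows "gaussian (m + \<sigma> * d) \<sigma> =
    density (gaussian m \<sigma>) (\<lambda>x. ennreal (exp (d * ((x - m) / \<sigma>) - d\<^sup>2 / 2)))"
  using assms
  by (subst density_density_eq)
    (auto simp: normal_density_shift ennreal_mult mult.commute intro!: density_cong)

lemma PiM_gaussian_shift:
  assumes "finite J" "\<sigma> > 0"
  shows "PiM J (\<lambda>j. gaussian (m j + \<sigma> * d j) \<sigma>) =
    density (PiM J (\<lambda>j. gaussian (m j) \<sigma>))
      (\<lambda>x. \<Prod>j\<in>J. ennreal (exp (d j * ((x j - m j) / \<sigma>) - (d j)\<^sup>2 / 2)))"
  unfolding gaussian_shift[OF assms(2)]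
proof (intro PiM_density assms sigma_finite_gaussian)
  show "sigma_finite_measure (density (gaussian (m j) \<sigma>)
      (\<lambda>x. ennreal (exp (d j * ((x - m j) / \<sigma>) - (d j)\<^sup>2 / 2))))" for j
    unfolding gaussian_shift[OF assms(2), symmetric] by (intro sigma_finite_gaussian assms)
qed measurable

definition gaussian_array ::
  "'i set \<Rightarrow> 'j set \<Rightarrow> real \<Rightarrow> ('i \<Rightarrow> 'j \<Rightarrow> real) \<Rightarrow> ('i \<Rightarrow> 'j \<Rightarrow> real) measure" where
  "gaussian_array I J \<sigma> m = (\<Pi>\<^sub>M i\<in>I. \<Pi>\<^sub>M j\<in>J. gaussian (m i j) \<sigma>)"

lemma prob_space_gaussian_array:
  "\<sigma> > 0 \<Longrightarrow> prob_space (gaussian_array I J \<sigma> m)"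
  unfolding gaussian_array_def by (intro prob_space_PiM prob_space_normal_density)

lemma sets_gaussian_array [measurable_cong]:
  "sets (gaussian_array I J \<sigma> m) = sets (\<Pi>\<^sub>M i\<in>I. \<Pi>\<^sub>M j\<in>J. borel)"
  unfolding gaussian_array_def by (intro sets_PiM_cong refl) simp

lemma space_gaussian_array:
  "space (gaussian_array I J \<sigma> m) = (\<Pi>\<^sub>E i\<in>I. \<Pi>\<^sub>E j\<in>J. UNIV)"
  by (simp add: gaussian_array_def space_PiM)

text \<open>
  The Cameron--Martin formula; shifts are measured in units of \<open>\<sigma>\<close>, so that the density does not
  involve \<open>\<sigma>\<close> apart from the standardised observations.
\<close>

lemma gaussian_array_shift:
  assumes "finite I" "finite J" "\<sigma> > 0"
  shows "gaussian_array I J \<sigma> (\<lambda>i j. m i j + \<sigma> * d i j) =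
    density (gaussian_array I J \<sigma> m)
      (\<lambda>y. \<Prod>i\<in>I. \<Prod>j\<in>J. ennreal (exp (d i j * ((y i j - m i j) / \<sigma>) - (d i j)\<^sup>2 / 2)))"
  unfolding gaussian_array_def PiM_gaussian_shift[OF assms(2,3)]
proof (intro PiM_density assms)
  show "sigma_finite_measure (PiM J (\<lambda>j. gaussian (m i j) \<sigma>))" for i
    by (intro prob_space_imp_sigma_finite prob_space_PiM prob_space_normal_density assms)
  show "sigma_finite_measure (density (PiM J (\<lambda>j. gaussian (m i j) \<sigma>))
      (\<lambda>x. \<Prod>j\<in>J. ennreal (exp (d i j * ((x j - m i j) / \<sigma>) - (d i j)\<^sup>2 / 2))))" for i
    unfolding PiM_gaussian_shift[OF assms(2,3), symmetric]
    by (intro prob_space_imp_sigma_finite prob_space_PiM prob_space_normal_density assms)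
qed measurable

lemma borel_measurable_cosh [measurable (raw)]:
  fixes f :: "'a \<Rightarrow> real"
  assumes "f \<in> borel_measurable M"
  shows "(\<lambda>x. cosh (f x)) \<in> borel_measurable M"
  using assms by (rule measurable_compose) (intro borel_measurable_continuous_onI continuous_intros)

lemma borel_measurable_column_sum [measurable]:
  assumes "j \<in> J"
  shows "(\<lambda>y. \<Sum>i\<in>I. u i * ((y i j - m' i j) / \<tau>)) \<in> borel_measurable (gaussian_array I J \<sigma> m)"
proof -
  have "(\<lambda>y. y i j) \<in> borel_measurable (gaussian_array I J \<sigma> m)" if "i \<in> I" for i
    using measurable_entry[OF that assms, of "\<lambda>i j. borel"]
    by (simp cong: measurable_cong_sets add: sets_gaussian_array)
  then show ?thesis
    by (intro borel_measurable_sum borel_measurable_times borel_measurable_const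
        borel_measurable_divide borel_measurable_diff)
qed

text \<open>
  The integrand times the normal density is, up to a constant, a shifted normal density.
\<close>

lemma has_bochner_integral_exp_gaussian:
  assumes "\<sigma> > 0"
  shows "has_bochner_integral (gaussian m \<sigma>) (\<lambda>x. exp (c * ((x - m) / \<sigma>))) (exp (c\<^sup>2 / 2))"
proof -
  have "has_bochner_integral lborel (\<lambda>x. exp (c\<^sup>2 / 2) * normal_density (m + \<sigma> * c) \<sigma> x) (exp (c\<^sup>2 / 2) * 1)"
    using assms by (intro has_bochner_integral_mult_right)
      (simp add: has_bochner_integral_iff)
  also have "(\<lambda>x. exp (c\<^sup>2 / 2) * normal_density (m + \<sigma> * c) \<sigma> x)
      = (\<lambda>x. normal_density m \<sigma> x *\<^sub>R exp (c * ((x - m) / \<sigma>)))"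
    unfolding normal_density_shift[OF assms]
    by (simp add: fun_eq_iff exp_diff)
  finally show ?thesis
    by (intro has_bochner_integral_density) simp_all
qed

lemma has_bochner_integral_exp_PiM_gaussian:
  assumes "finite I" "\<sigma> > 0"
  shows "has_bochner_integral (PiM I (\<lambda>i. gaussian (m i) \<sigma>))
    (\<lambda>y. exp (\<Sum>i\<in>I. c i * ((y i - m i) / \<sigma>))) (exp ((\<Sum>i\<in>I. (c i)\<^sup>2) / 2))"
proof -
  interpret product_sigma_finite "\<lambda>i. gaussian (m i) \<sigma>"
    by (rule product_sigma_finite.intro) (intro sigma_finite_gaussian assms)
  note G = has_bochner_integral_exp_gaussian[OF assms(2), unfolded has_bochner_integral_iff]
  have "integrable (PiM I (\<lambda>i. gaussian (m i) \<sigma>)) (\<lambda>y. \<Prod>i\<in>I. exp (c i * ((y i - m i) / \<sigma>)))"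
    using G by (intro product_integrable_prod assms) auto
  moreover have "(\<integral>y. (\<Prod>i\<in>I. exp (c i * ((y i - m i) / \<sigma>))) \<partial>PiM I (\<lambda>i. gaussian (m i) \<sigma>))
      = (\<Prod>i\<in>I. exp ((c i)\<^sup>2 / 2))"
    using G by (subst product_integral_prod) (auto simp: assms)
  ultimately show ?thesis
    using assms by (simp add: has_bochner_integral_iff exp_sum sum_divide_distrib)
qed


section \<open>The likelihood ratio in one coordinate\<close>

text \<open>
  The quotient on the left is not the exponential of a linear form, but it is dominated by a
  combination of such exponentials.  With \<open>w = tanh a * tanh x\<close> it equals
  \<open>cosh a * cosh x * (1 - w)\<^sup>2 / (1 + w)\<close>, and \<open>(1 - w)\<^sup>2 / (1 + w) = 1 - 3w + 4w\<^sup>2 / (1 + w)\<close>.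
  The term in \<open>w\<close> is odd in \<open>x\<close> and has mean zero.  The last term is quadratically small both in \<open>a\<close>
  and in \<open>x\<close>, since \<open>1 + w \<ge> 1 - \<bar>tanh x\<bar>\<close> stays away from \<open>0\<close> for bounded \<open>x\<close>; this double smallness is
  the source of the high-dimensional rate.
\<close>

lemma cosh_sq_over_cosh_le:
  fixes a x :: real
  shows "(cosh (a - x))\<^sup>2 / cosh (a + x)
    \<le> cosh a * cosh x - 3 * (sinh a * sinh x) + 4 * (cosh a - 1) * (cosh (3 * x) - cosh x)"
proof -
  define A S c h where "A = cosh a" and "S = sinh a" and "c = cosh x" and "h = sinh x"
  note D = this
  have A1: "A \<ge> 1" and c1: "c \<ge> 1"
    by (simp_all add: D cosh_real_ge_1)
  have S2: "S\<^sup>2 = A\<^sup>2 - 1" and h2: "h\<^sup>2 = c\<^sup>2 - 1"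
    by (simp_all add: D sinh_square_eq)
  have plus: "cosh (a + x) = A * c + S * h" and minus: "cosh (a - x) = A * c - S * h"
    by (simp_all add: D cosh_add cosh_diff)
  have pos: "A * c + S * h > 0"
    using cosh_real_pos[of "a + x"] by (simp add: plus)
  have triple: "cosh (3 * x) - cosh x = 4 * c * h\<^sup>2"
  proof -
    have "cosh (3 * x) = cosh (2 * x + x)" by simp
    also have "\<dots> = (c\<^sup>2 + h\<^sup>2) * c + 2 * h * c * h"
      by (simp only: cosh_add cosh_double sinh_double D)
    also have "\<dots> = (h\<^sup>2 + 1 + h\<^sup>2) * c + 2 * h * c * h"
      by (simp only: h2) simp
    finally show ?thesis
      by (simp add: D(3)[symmetric] distrib_right power2_eq_square)
  qed
  have "A * (c - \<bar>h\<bar>) \<le> A * c + S * h"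
  proof -
    have "\<bar>S\<bar> \<le> A"
      by (rule power2_le_imp_le) (use A1 in \<open>simp_all add: S2\<close>)
    then have "\<bar>S\<bar> * \<bar>h\<bar> \<le> A * \<bar>h\<bar>"
      by (intro mult_right_mono) auto
    then have "- (S * h) \<le> A * \<bar>h\<bar>"
      by (metis abs_le_D2 abs_mult)
    then show ?thesis by (simp add: algebra_simps)
  qed
  \<comment> \<open>This is \<open>exp (- \<bar>x\<bar>) \<ge> 1 / (2 cosh x)\<close>.\<close>
  moreover have "1 \<le> 2 * (c * (c - \<bar>h\<bar>))"
  proof -
    have "0 \<le> (c - \<bar>h\<bar>)\<^sup>2" by simp
    moreover have "\<bar>h\<bar>\<^sup>2 = c\<^sup>2 - 1" by (simp add: h2)
    ultimately show ?thesis by (simp add: power2_eq_square algebra_simps)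
  qed
  ultimately have "A + 1 \<le> 4 * c * (A * c + S * h)"
  proof -
    assume 1: "A * (c - \<bar>h\<bar>) \<le> A * c + S * h" and 2: "1 \<le> 2 * (c * (c - \<bar>h\<bar>))"
    have "A + 1 \<le> 2 * A * 1" using A1 by simp
    also have "\<dots> \<le> 2 * A * (2 * (c * (c - \<bar>h\<bar>)))"
      using 2 A1 by (intro mult_left_mono) auto
    also have "\<dots> = 4 * c * (A * (c - \<bar>h\<bar>))" by (simp add: algebra_simps)
    also have "\<dots> \<le> 4 * c * (A * c + S * h)"
      using 1 c1 by (intro mult_left_mono) auto
    finally show ?thesis .
  qed
  then have "4 * h\<^sup>2 * (A - 1) * (A + 1) \<le> 4 * h\<^sup>2 * (A - 1) * (4 * c * (A * c + S * h))"
    using A1 by (intro mult_left_mono) auto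
  moreover have "4 * h\<^sup>2 * (A - 1) * (A + 1) = 4 * h\<^sup>2 * S\<^sup>2"
    by (simp only: S2) (simp add: power2_eq_square algebra_simps)
  moreover have "(A * c - 3 * (S * h) + 4 * (A - 1) * (4 * c * h\<^sup>2)) * (A * c + S * h) - (A * c - S * h)\<^sup>2
      = 4 * h\<^sup>2 * (A - 1) * (4 * c * (A * c + S * h)) - 4 * h\<^sup>2 * S\<^sup>2"
    by (simp add: power2_eq_square algebra_simps)
  ultimately have "(A * c - S * h)\<^sup>2
      \<le> (A * c - 3 * (S * h) + 4 * (A - 1) * (4 * c * h\<^sup>2)) * (A * c + S * h)"
    by linarith
  then show ?thesis
    unfolding plus minus triple using pos by (simp add: pos_divide_le_eq D)
qed

text \<open>
  Orthogonality of \<open>c\<close> and \<open>d\<close> makes the two linear forms independent, with variances \<open>s\<close> and \<open>t\<close>.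
\<close>

lemma column_second_moment:
  fixes c d m :: "'i \<Rightarrow> real"
  assumes "finite I" "\<sigma> > 0" and orth: "(\<Sum>i\<in>I. c i * d i) = 0"
  defines "X \<equiv> \<lambda>(u::'i \<Rightarrow> real) y. \<Sum>i\<in>I. u i * ((y i - m i) / \<sigma>)"
  defines "s \<equiv> \<Sum>i\<in>I. (c i)\<^sup>2" and "t \<equiv> \<Sum>i\<in>I. (d i)\<^sup>2"
  shows "(\<integral>\<^sup>+y. ennreal (exp (- (s + t) / 2) * (cosh (X c y - X d y))\<^sup>2 / cosh (X c y + X d y))
            \<partial>PiM I (\<lambda>i. gaussian (m i) \<sigma>))
         \<le> ennreal (1 + 4 * (1 - exp (- s / 2)) * (exp (4 * t) - 1))"
proof -
  let ?G = "PiM I (\<lambda>i. gaussian (m i) \<sigma>)"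
  have E: "has_bochner_integral ?G (\<lambda>y. exp (k * X c y + l * X d y)) (exp (k\<^sup>2 * s / 2 + l\<^sup>2 * t / 2))"
    for k l :: real
  proof -
    have "(\<Sum>i\<in>I. (k * c i + l * d i)\<^sup>2) = (\<Sum>i\<in>I. k\<^sup>2 * (c i)\<^sup>2 + l\<^sup>2 * (d i)\<^sup>2 + 2 * k * l * (c i * d i))"
      by (intro sum.cong) (auto simp: power2_eq_square algebra_simps)
    also have "\<dots> = k\<^sup>2 * s + l\<^sup>2 * t"
      by (simp add: sum.distrib s_def t_def orth flip: sum_distrib_left)
    finally have "(\<Sum>i\<in>I. (k * c i + l * d i)\<^sup>2) / 2 = k\<^sup>2 * s / 2 + l\<^sup>2 * t / 2" by simp
    moreover have "(\<Sum>i\<in>I. (k * c i + l * d i) * ((y i - m i) / \<sigma>)) = k * X c y + l * X d y" for y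
      by (simp add: X_def algebra_simps sum.distrib sum_distrib_left)
    ultimately show ?thesis
      using has_bochner_integral_exp_PiM_gaussian[OF assms(1,2), of m "\<lambda>i. k * c i + l * d i"]
      by (simp add: add_divide_distrib)
  qed
  have ch: "has_bochner_integral ?G (\<lambda>y. cosh (k * X c y + l * X d y)) (exp (k\<^sup>2 * s / 2 + l\<^sup>2 * t / 2))"
    for k l :: real
  proof -
    have "has_bochner_integral ?G
        (\<lambda>y. (1/2) * (exp (k * X c y + l * X d y) + exp ((- k) * X c y + (- l) * X d y)))
        ((1/2) * (exp (k\<^sup>2 * s / 2 + l\<^sup>2 * t / 2) + exp ((- k)\<^sup>2 * s / 2 + (- l)\<^sup>2 * t / 2)))"
      by (intro has_bochner_integral_mult_right has_bochner_integral_add E)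
    then show ?thesis
      by (simp add: cosh_def)
  qed
  have cc: "has_bochner_integral ?G (\<lambda>y. cosh (k * X c y) * cosh (l * X d y)) (exp (k\<^sup>2 * s / 2 + l\<^sup>2 * t / 2))"
    for k l :: real
  proof -
    have "has_bochner_integral ?G
        (\<lambda>y. (1/2) * (cosh (k * X c y + l * X d y) + cosh (k * X c y + (- l) * X d y)))
        ((1/2) * (exp (k\<^sup>2 * s / 2 + l\<^sup>2 * t / 2) + exp (k\<^sup>2 * s / 2 + (- l)\<^sup>2 * t / 2)))"
      by (intro has_bochner_integral_mult_right has_bochner_integral_add ch)
    then show ?thesis
      by (simp add: cosh_add cosh_diff)
  qed
  have ss: "has_bochner_integral ?G (\<lambda>y. sinh (X c y) * sinh (X d y)) 0"
  proof -
    have "has_bochner_integral ?G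
        (\<lambda>y. (1/2) * (cosh (1 * X c y + 1 * X d y) - cosh (1 * X c y + (- 1) * X d y)))
        ((1/2) * (exp (1\<^sup>2 * s / 2 + 1\<^sup>2 * t / 2) - exp (1\<^sup>2 * s / 2 + (- 1)\<^sup>2 * t / 2)))"
      by (intro has_bochner_integral_mult_right has_bochner_integral_diff ch)
    then show ?thesis
      by (simp add: cosh_add cosh_diff)
  qed
  \<comment> \<open>The dominating combination, written with the explicit arguments that \<open>cc\<close> expects.\<close>
  define g where "g y = exp (- (s + t) / 2) * (cosh (1 * X c y) * cosh (1 * X d y) - 3 * (sinh (X c y) * sinh (X d y))
       + 4 * ((cosh (1 * X c y) * cosh (3 * X d y) - cosh (1 * X c y) * cosh (1 * X d y))
            - (cosh (0 * X c y) * cosh (3 * X d y) - cosh (0 * X c y) * cosh (1 * X d y))))" for y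
  have g: "has_bochner_integral ?G g (exp (- (s + t) / 2) * (exp (1\<^sup>2 * s / 2 + 1\<^sup>2 * t / 2) - 3 * 0
       + 4 * ((exp (1\<^sup>2 * s / 2 + 3\<^sup>2 * t / 2) - exp (1\<^sup>2 * s / 2 + 1\<^sup>2 * t / 2))
            - (exp (0\<^sup>2 * s / 2 + 3\<^sup>2 * t / 2) - exp (0\<^sup>2 * s / 2 + 1\<^sup>2 * t / 2)))))"
    unfolding g_def
    by (intro has_bochner_integral_mult_right has_bochner_integral_add has_bochner_integral_diff cc ss)
  have le: "exp (- (s + t) / 2) * (cosh (X c y - X d y))\<^sup>2 / cosh (X c y + X d y) \<le> g y" for y
  proof -
    have "g y = exp (- (s + t) / 2) * (cosh (X c y) * cosh (X d y) - 3 * (sinh (X c y) * sinh (X d y))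
        + 4 * (cosh (X c y) - 1) * (cosh (3 * X d y) - cosh (X d y)))"
      unfolding g_def by (intro arg_cong2[where f = "(*)"] refl) (simp add: left_diff_distrib right_diff_distrib)
    then show ?thesis
      using mult_left_mono[OF cosh_sq_over_cosh_le[of "X c y" "X d y"], of "exp (- (s + t) / 2)"]
      by simp
  qed
  have nonneg: "0 \<le> g y" for y
    by (rule order_trans[OF _ le]) (simp add: cosh_real_nonneg)
  have "(\<integral>\<^sup>+y. ennreal (exp (- (s + t) / 2) * (cosh (X c y - X d y))\<^sup>2 / cosh (X c y + X d y)) \<partial>?G)
      \<le> (\<integral>\<^sup>+y. ennreal (g y) \<partial>?G)"
    by (intro nn_integral_mono ennreal_leI le)
  also have "\<dots> = ennreal (integral\<^sup>L ?G g)"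
    using g nonneg by (intro nn_integral_eq_integral) (auto simp: has_bochner_integral_iff)
  also have "integral\<^sup>L ?G g = 1 + 4 * (1 - exp (- s / 2)) * (exp (4 * t) - 1)"
  proof -
    have "exp (- (s + t) / 2) * exp (s / 2 + t / 2) = 1"
      and "exp (- (s + t) / 2) * exp (s / 2 + 9 * t / 2) = exp (4 * t)"
      and "exp (- (s + t) / 2) * exp (9 * t / 2) = exp (- s / 2) * exp (4 * t)"
      and "exp (- (s + t) / 2) * exp (t / 2) = exp (- s / 2)"
      by (subst exp_add[symmetric]; simp add: field_simps)+
    moreover have "integral\<^sup>L ?G g = exp (- (s + t) / 2) * (exp (s / 2 + t / 2)
        + 4 * ((exp (s / 2 + 9 * t / 2) - exp (s / 2 + t / 2)) - (exp (9 * t / 2) - exp (t / 2))))"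
      using g by (simp add: has_bochner_integral_iff)
    ultimately show ?thesis
      by (simp only: distrib_left right_diff_distrib mult.left_commute[of _ 4]) (simp add: algebra_simps)
  qed
  finally show ?thesis .
qed


section \<open>Comparing two mixtures over signs\<close>

abbreviation sign_vectors :: "'j set \<Rightarrow> ('j \<Rightarrow> real) set" where
  "sign_vectors J \<equiv> J \<rightarrow>\<^sub>E {- 1, 1}"

text \<open>
  The sum over the sign vectors of the product over the coordinates is the product of two-term sums,
  each of which is a hyperbolic cosine.  The exponent of the Gaussian normalisation does not see the
  signs, because they square to one.
\<close>

lemma sum_emeasure_sign_mixture:
  fixes u :: "'i \<Rightarrow> real" and m :: "'i \<Rightarrow> 'j \<Rightarrow> real"
  assumes "finite I" "finite J" "\<sigma> > 0" and A: "A \<in> sets (\<Pi>\<^sub>M i\<in>I. \<Pi>\<^sub>M j\<in>J. borel)"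
  shows "(\<Sum>s\<in>sign_vectors J. emeasure (gaussian_array I J \<sigma> (\<lambda>i j. m i j + \<sigma> * (s j * u i))) A)
    = (\<integral>\<^sup>+y. ennreal (2 ^ card J * (\<Prod>j\<in>J. exp (- (\<Sum>i\<in>I. (u i)\<^sup>2) / 2)
          * cosh (\<Sum>i\<in>I. u i * ((y i j - m i j) / \<sigma>)))) * indicator A y
        \<partial>gaussian_array I J \<sigma> m)"
proof -
  let ?N = "gaussian_array I J \<sigma> m"
  define w where "w s y j = exp (- (\<Sum>i\<in>I. (u i)\<^sup>2) / 2) * exp (s * (\<Sum>i\<in>I. u i * ((y i j - m i j) / \<sigma>)))"
    for s :: real and y :: "'i \<Rightarrow> 'j \<Rightarrow> real" and j
  have w_nonneg: "0 \<le> w s y j" for s y j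
    by (simp add: w_def)
  have w_eq: "(\<Prod>i\<in>I. \<Prod>j\<in>J. ennreal (exp (s j * u i * ((y i j - m i j) / \<sigma>) - (s j * u i)\<^sup>2 / 2)))
      = ennreal (\<Prod>j\<in>J. w (s j) y j)" if s: "s \<in> sign_vectors J" for s y
  proof -
    have "(\<Prod>i\<in>I. exp (s j * u i * ((y i j - m i j) / \<sigma>) - (s j * u i)\<^sup>2 / 2)) = w (s j) y j"
      if j: "j \<in> J" for j
    proof -
      have sq: "(s j)\<^sup>2 = 1" using s j by (auto simp: PiE_iff)
      have "(\<Prod>i\<in>I. exp (s j * u i * ((y i j - m i j) / \<sigma>) - (s j * u i)\<^sup>2 / 2))
          = exp (\<Sum>i\<in>I. s j * (u i * ((y i j - m i j) / \<sigma>)) - (u i)\<^sup>2 / 2)"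
        by (simp add: exp_sum assms power_mult_distrib sq mult.assoc)
      also have "(\<Sum>i\<in>I. s j * (u i * ((y i j - m i j) / \<sigma>)) - (u i)\<^sup>2 / 2)
          = - (\<Sum>i\<in>I. (u i)\<^sup>2) / 2 + s j * (\<Sum>i\<in>I. u i * ((y i j - m i j) / \<sigma>))"
        by (simp only: sum_subtractf sum_distrib_left sum_divide_distrib)
          (simp add: sum_divide_distrib)
      finally show ?thesis by (simp only: w_def exp_add)
    qed
    then show ?thesis
      by (subst prod.swap) (simp add: prod_ennreal prod_nonneg w_nonneg)
  qed
  have A': "A \<in> sets ?N"
    using A by (simp add: sets_gaussian_array)
  have [measurable]: "(\<lambda>y. w s y j) \<in> borel_measurable ?N" if "j \<in> J" for j s
    unfolding w_def
    using that by (intro borel_measurable_times borel_measurable_const measurable_compose[OF _ borel_measurable_exp] borel_measurable_column_sum)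
  have "emeasure (gaussian_array I J \<sigma> (\<lambda>i j. m i j + \<sigma> * (s j * u i))) A
      = (\<integral>\<^sup>+y. ennreal (\<Prod>j\<in>J. w (s j) y j) * indicator A y \<partial>?N)" if s: "s \<in> sign_vectors J" for s
    unfolding gaussian_array_shift[OF assms(1-3)] w_eq[OF s]
    by (rule emeasure_density) (use A' in measurable)
  then have "(\<Sum>s\<in>sign_vectors J. emeasure (gaussian_array I J \<sigma> (\<lambda>i j. m i j + \<sigma> * (s j * u i))) A)
      = (\<Sum>s\<in>sign_vectors J. \<integral>\<^sup>+y. ennreal (\<Prod>j\<in>J. w (s j) y j) * indicator A y \<partial>?N)"
    by simp
  also have "\<dots> = (\<integral>\<^sup>+y. (\<Sum>s\<in>sign_vectors J. ennreal (\<Prod>j\<in>J. w (s j) y j) * indicator A y) \<partial>?N)"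
    by (intro nn_integral_sum[symmetric] borel_measurable_times_ennreal borel_measurable_indicator A')
      measurable
  also have "\<dots> = (\<integral>\<^sup>+y. ennreal (\<Sum>s\<in>sign_vectors J. \<Prod>j\<in>J. w (s j) y j) * indicator A y \<partial>?N)"
    by (simp add: sum_distrib_right[symmetric] sum_ennreal prod_nonneg w_def)
  also have "\<dots> = (\<integral>\<^sup>+y. ennreal (\<Prod>j\<in>J. \<Sum>s\<in>{- 1, 1}. w s y j) * indicator A y \<partial>?N)"
    using assms by (subst prod_sum_PiE) simp_all
  also have "(\<lambda>y. \<Prod>j\<in>J. \<Sum>s\<in>{- 1, 1}. w s y j) = (\<lambda>y. 2 ^ card J * (\<Prod>j\<in>J. exp (- (\<Sum>i\<in>I. (u i)\<^sup>2) / 2)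
          * cosh (\<Sum>i\<in>I. u i * ((y i j - m i j) / \<sigma>))))"
  proof
    fix y
    have "(\<Sum>s\<in>{- 1, 1}. w s y j) = 2 * (exp (- (\<Sum>i\<in>I. (u i)\<^sup>2) / 2)
        * cosh (\<Sum>i\<in>I. u i * ((y i j - m i j) / \<sigma>)))" for j
      unfolding w_def cosh_def by (simp add: distrib_left)
    then show "(\<Prod>j\<in>J. \<Sum>s\<in>{- 1, 1}. w s y j) = 2 ^ card J * (\<Prod>j\<in>J. exp (- (\<Sum>i\<in>I. (u i)\<^sup>2) / 2)
          * cosh (\<Sum>i\<in>I. u i * ((y i j - m i j) / \<sigma>)))"
      by (simp only: prod.distrib prod_constant)
  qed
  finally show ?thesis .
qed

lemma prod_mono_ennreal:
  fixes f g :: "'a \<Rightarrow> ennreal"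
  assumes "\<And>x. x \<in> A \<Longrightarrow> f x \<le> g x"
  shows "prod f A \<le> prod g A"
  using assms by (induction A rule: infinite_finite_induct) (auto intro: mult_mono)

text \<open>
  The arithmetic-geometric mean inequality, in the form that replaces the Cauchy--Schwarz
  inequality: being linear in \<open>b\<close>, it can be summed without Jensen's inequality.
\<close>

lemma le_linear_plus_quotient:
  fixes a b \<tau> :: real
  assumes "b > 0" "\<tau> > 0"
  shows "a \<le> \<tau> / 2 * b + 1 / (2 * \<tau>) * (a\<^sup>2 / b)"
proof -
  have "0 \<le> (\<tau> * b - a)\<^sup>2 / (2 * \<tau> * b)"
    using assms by simp
  also have "\<dots> = \<tau> / 2 * b + 1 / (2 * \<tau>) * (a\<^sup>2 / b) - a"
    using assms by (simp add: field_simps power2_eq_square)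
  finally show ?thesis by simp
qed

text \<open>
  In the application \<open>d\<close> is supported on the two swapped observations and \<open>c\<close> on the other observations
  of the pair, so that changing the sign of \<open>d\<close> is the swap.
\<close>

lemma sign_mixture_comparison:
  fixes c d :: "'i \<Rightarrow> real" and m :: "'i \<Rightarrow> 'j \<Rightarrow> real"
  assumes "finite I" "finite J" "\<sigma> > 0" "\<tau> > 0"
    and A: "A \<in> sets (\<Pi>\<^sub>M i\<in>I. \<Pi>\<^sub>M j\<in>J. borel)"
    and orth: "(\<Sum>i\<in>I. c i * d i) = 0"
  defines "B \<equiv> 1 + 4 * (1 - exp (- (\<Sum>i\<in>I. (c i)\<^sup>2) / 2)) * (exp (4 * (\<Sum>i\<in>I. (d i)\<^sup>2)) - 1)"
  shows "(\<Sum>s\<in>sign_vectors J. measure (gaussian_array I J \<sigma> (\<lambda>i j. m i j + \<sigma> * (s j * (c i - d i)))) A)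
    \<le> \<tau> / 2 * (\<Sum>s\<in>sign_vectors J. measure (gaussian_array I J \<sigma> (\<lambda>i j. m i j + \<sigma> * (s j * (c i + d i)))) A)
      + 2 ^ card J * B ^ card J / (2 * \<tau>)"
proof -
  let ?N = "gaussian_array I J \<sigma> m"
  define s where "s = (\<Sum>i\<in>I. (c i)\<^sup>2)"
  define t where "t = (\<Sum>i\<in>I. (d i)\<^sup>2)"
  have B1: "B \<ge> 1"
    unfolding B_def by (simp add: sum_nonneg)
  define X where "X u x = (\<lambda>y. \<Sum>i\<in>I. u i * ((y i - x i) / \<sigma>))" for u x :: "'i \<Rightarrow> real"
  have norm: "(\<Sum>i\<in>I. (c i + d i)\<^sup>2) = s + t" "(\<Sum>i\<in>I. (c i - d i)\<^sup>2) = s + t"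
    by (simp_all add: power2_sum power2_diff sum.distrib sum_subtractf s_def t_def mult.assoc orth
        flip: sum_distrib_left)
  define p q where "p y = (\<Prod>j\<in>J. exp (- (s + t) / 2) * cosh (\<Sum>i\<in>I. (c i + d i) * ((y i j - m i j) / \<sigma>)))"
    and "q y = (\<Prod>j\<in>J. exp (- (s + t) / 2) * cosh (\<Sum>i\<in>I. (c i - d i) * ((y i j - m i j) / \<sigma>)))"
    for y
  have p_pos: "p y > 0" and q_pos: "q y > 0" for y
    by (auto simp: p_def q_def intro!: prod_pos)
  have A': "A \<in> sets ?N"
    using A by (simp add: sets_gaussian_array)
  have [measurable]: "p \<in> borel_measurable ?N" "q \<in> borel_measurable ?N"
    unfolding p_def q_def
    by (intro borel_measurable_prod borel_measurable_times borel_measurable_const borel_measurable_cosh borel_measurable_column_sum; assumption)+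
  define F where "F j y = ennreal (exp (- (s + t) / 2)
      * (cosh (X c (\<lambda>i. m i j) y - X d (\<lambda>i. m i j) y))\<^sup>2 / cosh (X c (\<lambda>i. m i j) y + X d (\<lambda>i. m i j) y))" for j y
  have F_meas: "F j \<in> borel_measurable (PiM I (\<lambda>i. gaussian (m i j) \<sigma>))" for j
    unfolding F_def X_def by measurable
  have quotient: "ennreal ((q y)\<^sup>2 / p y) = (\<Prod>j\<in>J. F j (\<lambda>i\<in>I. y i j))" for y
  proof -
    have "(q y)\<^sup>2 / p y = (\<Prod>j\<in>J. (exp (- (s + t) / 2) * cosh (\<Sum>i\<in>I. (c i - d i) * ((y i j - m i j) / \<sigma>)))\<^sup>2
        / (exp (- (s + t) / 2) * cosh (\<Sum>i\<in>I. (c i + d i) * ((y i j - m i j) / \<sigma>))))"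
      by (simp only: p_def q_def prod_power_distrib prod_dividef)
    also have "\<dots> = (\<Prod>j\<in>J. exp (- (s + t) / 2)
      * (cosh (X c (\<lambda>i. m i j) (\<lambda>i\<in>I. y i j) - X d (\<lambda>i. m i j) (\<lambda>i\<in>I. y i j)))\<^sup>2
      / cosh (X c (\<lambda>i. m i j) (\<lambda>i\<in>I. y i j) + X d (\<lambda>i. m i j) (\<lambda>i\<in>I. y i j)))"
    proof (rule prod.cong[OF refl])
      fix j
      have "(\<Sum>i\<in>I. (c i + d i) * ((y i j - m i j) / \<sigma>))
          = X c (\<lambda>i. m i j) (\<lambda>i\<in>I. y i j) + X d (\<lambda>i. m i j) (\<lambda>i\<in>I. y i j)"
        by (simp only: X_def distrib_right sum.distrib) simp
      moreover have "(\<Sum>i\<in>I. (c i - d i) * ((y i j - m i j) / \<sigma>))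
          = X c (\<lambda>i. m i j) (\<lambda>i\<in>I. y i j) - X d (\<lambda>i. m i j) (\<lambda>i\<in>I. y i j)"
        by (simp only: X_def left_diff_distrib sum_subtractf) simp
      moreover have "(e * a)\<^sup>2 / (e * b) = e * a\<^sup>2 / b" if "e > 0" for e a b :: real
        using that by (simp add: power2_eq_square)
      ultimately show "(exp (- (s + t) / 2) * cosh (\<Sum>i\<in>I. (c i - d i) * ((y i j - m i j) / \<sigma>)))\<^sup>2
          / (exp (- (s + t) / 2) * cosh (\<Sum>i\<in>I. (c i + d i) * ((y i j - m i j) / \<sigma>)))
        = exp (- (s + t) / 2) * (cosh (X c (\<lambda>i. m i j) (\<lambda>i\<in>I. y i j) - X d (\<lambda>i. m i j) (\<lambda>i\<in>I. y i j)))\<^sup>2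
          / cosh (X c (\<lambda>i. m i j) (\<lambda>i\<in>I. y i j) + X d (\<lambda>i. m i j) (\<lambda>i\<in>I. y i j))"
        by simp
    qed
    finally show ?thesis
      unfolding F_def by (simp add: prod_ennreal)
  qed
  have second_moment: "(\<integral>\<^sup>+y. ennreal ((q y)\<^sup>2 / p y) \<partial>?N) \<le> ennreal (B ^ card J)"
  proof -
    have "(\<integral>\<^sup>+y. ennreal ((q y)\<^sup>2 / p y) \<partial>?N)
        = (\<Prod>j\<in>J. \<integral>\<^sup>+y. F j y \<partial>PiM I (\<lambda>i. gaussian (m i j) \<sigma>))"
      unfolding quotient gaussian_array_def
      by (intro nn_integral_PiM_prod_columns assms sigma_finite_gaussian F_meas)
    also have "\<dots> \<le> (\<Prod>j\<in>J. ennreal B)"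
      unfolding F_def X_def B_def s_def t_def
      by (intro prod_mono_ennreal column_second_moment[OF assms(1,3) orth])
    also have "\<dots> = ennreal (B ^ card J)"
      using B1 by (simp add: ennreal_power)
    finally show ?thesis .
  qed
  define P where "P u s = gaussian_array I J \<sigma> (\<lambda>i j. m i j + \<sigma> * (s j * u i))" for u s
  have fin: "emeasure (P u s) A = ennreal (measure (P u s) A)" for u s
    unfolding P_def
    by (intro finite_measure.emeasure_eq_measure prob_space.finite_measure prob_space_gaussian_array assms)
  have "ennreal (\<Sum>s\<in>sign_vectors J. measure (P (\<lambda>i. c i - d i) s) A)
      = (\<Sum>s\<in>sign_vectors J. emeasure (P (\<lambda>i. c i - d i) s) A)"
    by (simp add: fin sum_ennreal)
  also have "\<dots> = (\<integral>\<^sup>+y. ennreal (2 ^ card J * q y) * indicator A y \<partial>?N)"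
    unfolding P_def q_def using sum_emeasure_sign_mixture[OF assms(1-3) A, of m "\<lambda>i. c i - d i"]
    by (simp only: norm)
  also have "\<dots> \<le> (\<integral>\<^sup>+y. ennreal (\<tau> / 2) * (ennreal (2 ^ card J * p y) * indicator A y)
      + ennreal (2 ^ card J / (2 * \<tau>)) * ennreal ((q y)\<^sup>2 / p y) \<partial>?N)"
  proof (rule nn_integral_mono)
    fix y
    have "2 ^ card J * q y \<le> 2 ^ card J * (\<tau> / 2 * p y + 1 / (2 * \<tau>) * ((q y)\<^sup>2 / p y))"
      by (intro mult_left_mono le_linear_plus_quotient p_pos assms) simp
    also have "\<dots> = \<tau> / 2 * (2 ^ card J * p y) + 2 ^ card J / (2 * \<tau>) * ((q y)\<^sup>2 / p y)"
      by (simp add: algebra_simps)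
    finally have "ennreal (2 ^ card J * q y)
        \<le> ennreal (\<tau> / 2) * ennreal (2 ^ card J * p y) + ennreal (2 ^ card J / (2 * \<tau>)) * ennreal ((q y)\<^sup>2 / p y)"
      using p_pos[of y] assms(4) by (simp flip: ennreal_mult ennreal_plus add: ennreal_leI)
    then show "ennreal (2 ^ card J * q y) * indicator A y
        \<le> ennreal (\<tau> / 2) * (ennreal (2 ^ card J * p y) * indicator A y)
          + ennreal (2 ^ card J / (2 * \<tau>)) * ennreal ((q y)\<^sup>2 / p y)"
      by (simp split: split_indicator)
  qed
  also have "\<dots> = ennreal (\<tau> / 2) * (\<integral>\<^sup>+y. ennreal (2 ^ card J * p y) * indicator A y \<partial>?N)
      + ennreal (2 ^ card J / (2 * \<tau>)) * (\<integral>\<^sup>+y. ennreal ((q y)\<^sup>2 / p y) \<partial>?N)"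
    using A' by (simp add: nn_integral_add nn_integral_cmult)
  also have "(\<integral>\<^sup>+y. ennreal (2 ^ card J * p y) * indicator A y \<partial>?N)
      = (\<Sum>s\<in>sign_vectors J. emeasure (P (\<lambda>i. c i + d i) s) A)"
    unfolding P_def p_def using sum_emeasure_sign_mixture[OF assms(1-3) A, of m "\<lambda>i. c i + d i"]
    by (simp only: norm)
  also have "\<dots> = ennreal (\<Sum>s\<in>sign_vectors J. measure (P (\<lambda>i. c i + d i) s) A)"
    by (simp add: fin sum_ennreal)
  also have "ennreal (\<tau> / 2) * ennreal (\<Sum>s\<in>sign_vectors J. measure (P (\<lambda>i. c i + d i) s) A)
      + ennreal (2 ^ card J / (2 * \<tau>)) * (\<integral>\<^sup>+y. ennreal ((q y)\<^sup>2 / p y) \<partial>?N)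
    \<le> ennreal (\<tau> / 2) * ennreal (\<Sum>s\<in>sign_vectors J. measure (P (\<lambda>i. c i + d i) s) A)
      + ennreal (2 ^ card J / (2 * \<tau>)) * ennreal (B ^ card J)"
    by (intro add_left_mono mult_left_mono second_moment) simp
  also have "\<dots> = ennreal (\<tau> / 2 * (\<Sum>s\<in>sign_vectors J. measure (P (\<lambda>i. c i + d i) s) A)
      + 2 ^ card J * B ^ card J / (2 * \<tau>))"
    using assms(4) B1 by (simp flip: ennreal_mult ennreal_plus add: sum_nonneg)
  finally show ?thesis
    using assms(4) B1 unfolding P_def by (subst (asm) ennreal_le_iff) (auto intro!: add_nonneg_nonneg mult_nonneg_nonneg sum_nonneg)
qed


section \<open>Partitions by residues, and swaps of neighbours\<close>

text \<open>
  Residues start at \<open>0\<close> and group numbers at \<open>1\<close>, whence the successor.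
\<close>

definition groups_by :: "nat \<Rightarrow> nat \<Rightarrow> (nat \<Rightarrow> nat) \<Rightarrow> nat \<Rightarrow> nat set" where
  "groups_by n K \<rho> = (\<lambda>k\<in>{1..K}. {i \<in> {1..n}. Suc (\<rho> i) = k})"

lemma group_of_groups_by:
  assumes "i \<in> {1..n}" "\<rho> i < K"
  shows "group_of K (groups_by n K \<rho>) i = Suc (\<rho> i)"
  using assms unfolding group_of_def groups_by_def by (intro the_equality) auto

text \<open>
  An unordered partition determines which elements lie together.  This is how swapped partitions are
  told apart although the numbering of their groups is forgotten.
\<close>

lemma groups_by_eq_same_block:
  assumes eq: "groups_by n K \<rho> ` {1..K} = groups_by n K \<rho>' ` {1..K}"
    and "x \<in> {1..n}" "y \<in> {1..n}" "\<rho>' x < K" and same: "\<rho>' x = \<rho>' y"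
  shows "\<rho> x = \<rho> y"
proof -
  let ?B = "groups_by n K \<rho>' (Suc (\<rho>' x))"
  have "x \<in> ?B" "y \<in> ?B"
    using assms by (auto simp: groups_by_def)
  moreover have "?B \<in> groups_by n K \<rho> ` {1..K}"
    unfolding eq using assms by (intro imageI) auto
  ultimately show ?thesis
    by (auto simp: groups_by_def)
qed

lemma card_residue_class:
  assumes "r < K"
  shows "n div K \<le> card {i \<in> {1..n}. i mod K = r}"
    and "card {i \<in> {1..n}. i mod K = r} \<le> Suc (n div K)"
proof -
  let ?r = "if r = 0 then K else r"
  have "inj_on (\<lambda>t. t * K + ?r) {..<n div K}"
    using assms by (auto simp: inj_on_def)
  moreover have "(\<lambda>t. t * K + ?r) ` {..<n div K} \<subseteq> {i \<in> {1..n}. i mod K = r}"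
  proof safe
    fix t assume "t < n div K"
    then have "Suc t * K \<le> n"
      by (intro order_trans[OF mult_le_mono1 div_times_less_eq_dividend]) simp
    moreover have "?r \<le> K" "0 < ?r" "?r mod K = r"
      using assms by auto
    moreover have "(t * K + ?r) mod K = ?r mod K"
      by (rule mod_mult_self3)
    ultimately show "t * K + ?r \<in> {1..n}" "(t * K + ?r) mod K = r"
      by auto
  qed
  ultimately show "n div K \<le> card {i \<in> {1..n}. i mod K = r}"
    using card_inj_on_le[of "\<lambda>t. t * K + ?r" "{..<n div K}"] by simp
next
  have "inj_on (\<lambda>i. i div K) {i \<in> {1..n}. i mod K = r}"
    by (auto simp: inj_on_def) (metis div_mult_mod_eq)
  moreover have "(\<lambda>i. i div K) ` {i \<in> {1..n}. i mod K = r} \<subseteq> {..n div K}"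
    by (auto intro: div_le_mono)
  ultimately show "card {i \<in> {1..n}. i mod K = r} \<le> Suc (n div K)"
    using card_inj_on_le[of "\<lambda>i. i div K" _ "{..n div K}"] by simp
qed

definition swapped_residue :: "nat \<Rightarrow> nat \<Rightarrow> nat \<Rightarrow> nat" where
  "swapped_residue K l i = Transposition.transpose l (Suc l) i mod K"

lemma groups_by_swapped_balanced:
  assumes K: "K \<ge> 1" and n: "4 * K \<le> n" and l: "1 \<le> l" "Suc l \<le> n" and \<alpha>: "\<alpha> \<ge> 3 / 2"
  shows "groups_by n K (swapped_residue K l) \<in> balanced_partitions n K \<alpha>"
proof -
  let ?G = "groups_by n K (swapped_residue K l)" and ?q = "n div K"
  have q: "?q \<ge> 4"
    using K n by (simp add: less_eq_div_iff_mult_less_eq)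
  have card: "card (?G k) = card {i \<in> {1..n}. i mod K = k - 1}" if k: "k \<in> {1..K}" for k
  proof -
    have mem: "Transposition.transpose l (Suc l) i \<in> {1..n} \<longleftrightarrow> i \<in> {1..n}" for i
      using l by (auto simp: Transposition.transpose_def)
    have "?G k = Transposition.transpose l (Suc l) ` {i \<in> {1..n}. i mod K = k - 1}"
    proof (intro set_eqI iffI)
      fix i assume "i \<in> ?G k"
      then have "Transposition.transpose l (Suc l) i \<in> {i \<in> {1..n}. i mod K = k - 1}"
        using k mem[of i] by (auto simp: groups_by_def swapped_residue_def)
      then have "Transposition.transpose l (Suc l) (Transposition.transpose l (Suc l) i)
          \<in> Transposition.transpose l (Suc l) ` {i \<in> {1..n}. i mod K = k - 1}"
        by (rule imageI)
      then show "i \<in> Transposition.transpose l (Suc l) ` {i \<in> {1..n}. i mod K = k - 1}"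
        by simp
    next
      fix i assume "i \<in> Transposition.transpose l (Suc l) ` {i \<in> {1..n}. i mod K = k - 1}"
      then obtain x where "i = Transposition.transpose l (Suc l) x" "x \<in> {1..n}" "x mod K = k - 1"
        by blast
      then show "i \<in> ?G k"
        using k mem[of x] by (auto simp: groups_by_def swapped_residue_def)
    qed
    then show ?thesis
      by (simp add: card_image)
  qed
  have lower: "?q \<le> card (?G k)" and upper: "card (?G k) \<le> Suc ?q" if "k \<in> {1..K}" for k
  proof -
    have "k - 1 < K" using that by auto
    then show "?q \<le> card (?G k)" "card (?G k) \<le> Suc ?q"
      unfolding card[OF that] by (rule card_residue_class)+
  qed
  have "?G \<in> numbered_partitions n K"
    unfolding numbered_partitions_def
  proof (intro CollectI conjI ballI)
    show "?G \<in> {1..K} \<rightarrow>\<^sub>E Pow {1..n}"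
      by (auto simp: groups_by_def)
    show "?G k \<noteq> {}" if "k \<in> {1..K}" for k
      using lower[OF that] q by auto
    show "disjoint_family_on ?G {1..K}"
      by (auto simp: disjoint_family_on_def groups_by_def)
    have "\<exists>k\<in>{1..K}. i \<in> ?G k" if "i \<in> {1..n}" for i
      using K that by (intro bexI[of _ "Suc (swapped_residue K l i)"])
        (auto simp: groups_by_def swapped_residue_def Suc_le_eq)
    then show "(\<Union>k\<in>{1..K}. ?G k) = {1..n}"
      by (auto simp: groups_by_def)
  qed
  moreover have "real (MAX k\<in>{1..K}. card (?G k)) / real (MIN k\<in>{1..K}. card (?G k)) \<le> \<alpha>"
  proof -
    have "(MAX k\<in>{1..K}. card (?G k)) \<le> Suc ?q"
      using K upper by (intro Max.boundedI) auto
    then have "real (MAX k\<in>{1..K}. card (?G k)) \<le> real ?q + 1"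
      by linarith
    moreover have "?q \<le> (MIN k\<in>{1..K}. card (?G k))"
      using K lower by (intro Min.boundedI) auto
    ultimately have "real (MAX k\<in>{1..K}. card (?G k)) / real (MIN k\<in>{1..K}. card (?G k))
        \<le> (real ?q + 1) / real ?q"
      using q by (intro frac_le) auto
    also have "\<dots> \<le> 3 / 2"
      using q by (simp add: field_simps)
    finally show ?thesis using \<alpha> by (rule order_trans)
  qed
  ultimately show ?thesis
    by (simp add: balanced_partitions_def)
qed

text \<open>
  At these sites \<open>l\<close> and \<open>Suc l\<close> belong to the two groups of one pair, because \<open>2 * b\<close> is an even residue
  other than \<open>K - 1\<close>.  The range of \<open>t\<close> keeps both in \<open>{1..n}\<close>.
\<close>

definition swap_sites :: "nat \<Rightarrow> nat \<Rightarrow> nat set" where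
  "swap_sites n K = (\<lambda>(t, b). t * K + 2 * b) ` ({1..<n div K} \<times> {..<K div 2})"

lemma swap_sitesD:
  assumes "l \<in> swap_sites n K"
  shows "1 \<le> l" "Suc l \<le> n" "even (l mod K)" "Suc (l mod K) < K" "Suc l mod K = Suc (l mod K)"
proof -
  obtain t b where l: "l = t * K + 2 * b" and t: "1 \<le> t" "t < n div K" and b: "b < K div 2"
    using assms by (auto simp: swap_sites_def)
  have b': "Suc (2 * b) < K"
    using b by presburger
  then have r: "l mod K = 2 * b"
    by (simp add: l)
  show "even (l mod K)" "Suc (l mod K) < K"
    using r b' by auto
  then show "Suc l mod K = Suc (l mod K)"
    by (simp add: mod_Suc)
  have "0 < t * K"
    using t b' by simp
  then show "1 \<le> l"
    unfolding l by linarith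
  have "Suc l \<le> Suc t * K"
    using b' by (simp add: l)
  also have "\<dots> \<le> n div K * K"
    using t by (intro mult_le_mono) auto
  also have "\<dots> \<le> n" by simp
  finally show "Suc l \<le> n" .
qed

lemma finite_swap_sites [simp]: "finite (swap_sites n K)"
  by (simp add: swap_sites_def)

lemma card_swap_sites:
  assumes "K \<ge> 2" "9 * K \<le> 2 * n"
  shows "real n / 6 \<le> real (card (swap_sites n K))"
proof -
  let ?q = "n div K"
  have "inj_on (\<lambda>(t, b). t * K + 2 * b) ({1..<?q} \<times> {..<K div 2})"
  proof (intro inj_onI; clarify)
    fix t b t' b' assume b: "b < K div 2" "b' < K div 2" and eq: "t * K + 2 * b = t' * K + 2 * b'"
    have "2 * b < K" "2 * b' < K"
      using b by presburger+
    then have "(t * K + 2 * b) mod K = 2 * b" "(t' * K + 2 * b') mod K = 2 * b'"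
      by simp_all
    with eq have "b = b'"
      by simp
    with eq \<open>2 * b < K\<close> show "t = t' \<and> b = b'"
      by simp
  qed
  then have card: "card (swap_sites n K) = (?q - 1) * (K div 2)"
    by (simp add: swap_sites_def card_image card_cartesian_product)
  have "n < Suc ?q * K"
    using assms by (metis dividend_less_times_div mult.commute mult_Suc_right not_numeral_le_zero
        gr0I)
  moreover have q: "?q \<ge> 4"
    using assms by (simp add: less_eq_div_iff_mult_less_eq)
  ultimately have "real n < real (Suc ?q * K)" "real (Suc ?q) = real (?q - 1) + 2"
    by linarith+
  then have "real n < (real (?q - 1) + 2) * real K"
    by (simp only: of_nat_mult)
  moreover have "9 * real K \<le> 2 * real n"
    using assms(2) by linarith
  ultimately have "5 * real n \<le> 9 * (real (?q - 1) * real K)"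
    by (simp only: distrib_right)
  moreover have "K \<le> 3 * (K div 2)"
    using assms(1) by presburger
  then have "real K \<le> 3 * real (K div 2)"
    by linarith
  then have "real (?q - 1) * real K \<le> real (?q - 1) * (3 * real (K div 2))"
    by (intro mult_left_mono) auto
  ultimately show ?thesis
    by (simp add: card)
qed

text \<open>
  Each residue class has at least four elements, so the class of \<open>l\<close> has a member \<open>y\<close> that neither swap
  moves.  The swap at \<open>l\<close> separates \<open>l\<close> from \<open>y\<close>, whereas the swap at \<open>l'\<close> leaves them together.
\<close>

lemma groups_by_swapped_distinct:
  assumes n: "4 * K \<le> n" and l: "l \<in> swap_sites n K" "l' \<in> swap_sites n K" and "l \<noteq> l'"
  shows "groups_by n K (swapped_residue K l) ` {1..K} \<noteq> groups_by n K (swapped_residue K l') ` {1..K}"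
proof
  assume eq: "groups_by n K (swapped_residue K l) ` {1..K} = groups_by n K (swapped_residue K l') ` {1..K}"
  note s = swap_sitesD[OF l(1)] and s' = swap_sitesD[OF l(2)]
  have K: "K > 0" using s(4) by simp
  have "4 \<le> n div K"
    using K n by (simp add: less_eq_div_iff_mult_less_eq)
  also have "\<dots> \<le> card {i \<in> {1..n}. i mod K = l mod K}"
    using K by (intro card_residue_class) simp
  finally have "\<not> {i \<in> {1..n}. i mod K = l mod K} \<subseteq> {l, l'}"
    using card_mono[of "{l, l'}" "{i \<in> {1..n}. i mod K = l mod K}"] card_insert_le_m1[of 2 "{l'}" l]
    by (auto simp: card_insert_if split: if_splits)
  then obtain y where y: "y \<in> {1..n}" "y mod K = l mod K" "y \<noteq> l" "y \<noteq> l'"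
    by blast
  have "y \<noteq> Suc l" using y s by auto
  have "y \<noteq> Suc l'" "l \<noteq> Suc l'"
    using y s s' by (metis even_Suc)+
  then have "swapped_residue K l' l = swapped_residue K l' y"
    using y \<open>l \<noteq> l'\<close> by (simp add: swapped_residue_def)
  then have "swapped_residue K l l = swapped_residue K l y"
    using s y K by (intro groups_by_eq_same_block[OF eq]) (auto simp: swapped_residue_def)
  then show False
    using y s \<open>y \<noteq> Suc l\<close> by (simp add: swapped_residue_def)
qed

section \<open>Paired centers\<close>

text \<open>
  The restrictions give the family the extensional form that \<^const>\<open>separated_means\<close> demands.
\<close>

definition centers :: "nat \<Rightarrow> nat \<Rightarrow> (nat \<Rightarrow> nat \<Rightarrow> real) \<Rightarrow> nat \<Rightarrow> nat \<Rightarrow> real" where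
  "centers K p x = (\<lambda>k\<in>{1..K}. \<lambda>j\<in>{1..p}. x (k - 1) j)"

text \<open>
  The residues \<open>2 * b\<close> and \<open>2 * b + 1\<close> form pair \<open>b\<close>: their centers lie at \<open>v b\<close> and \<open>- v b\<close>, scaled by \<open>\<delta>\<close>,
  around the point \<open>R * b\<close> of the first axis.  If \<open>K\<close> is odd, the last residue is alone in its pair.
\<close>

definition pair_center :: "real \<Rightarrow> real \<Rightarrow> (nat \<Rightarrow> nat \<Rightarrow> real) \<Rightarrow> nat \<Rightarrow> nat \<Rightarrow> real" where
  "pair_center R \<delta> v r j = (if j = 1 then R * real (r div 2) else 0) + \<delta> * ((- 1) ^ r * v (r div 2) j)"

text \<open>
  Within a pair the distance is the same for all sign vectors, and \<open>\<epsilon>\<close> is chosen to make it the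
  required one.  Distinct pairs are already separated by their first coordinates: the offsets
  differ by at least \<open>2 * \<sigma> * (\<epsilon> + \<Delta>)\<close>, and the signs take away at most \<open>2 * \<sigma> * \<epsilon>\<close>.
\<close>

lemma pair_centers_separated:
  assumes K: "K \<ge> 2" and p: "p \<ge> 1" and \<sigma>: "\<sigma> > 0" and \<Delta>: "\<Delta> > 0"
    and v: "v \<in> {..<K} \<rightarrow>\<^sub>E ({1..p} \<rightarrow>\<^sub>E {- 1, 1})"
  defines "\<epsilon> \<equiv> \<Delta> / sqrt (2 * real p)"
  shows "centers K p (pair_center (2 * \<sigma> * (\<epsilon> + \<Delta>)) (\<sigma> * \<epsilon>) v) \<in> separated_means K p \<sigma> \<Delta>"
proof -
  let ?R = "2 * \<sigma> * (\<epsilon> + \<Delta>)"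
  let ?x = "pair_center ?R (\<sigma> * \<epsilon>) v"
  let ?D = "{(L2_set (\<lambda>j. centers K p ?x r j - centers K p ?x l j) {1..p})\<^sup>2 / (2 * \<sigma>\<^sup>2) | l r.
               l \<in> {1..K} \<and> r \<in> {1..K} \<and> l \<noteq> r}"
  have \<epsilon>: "\<epsilon> > 0" "\<epsilon>\<^sup>2 = \<Delta>\<^sup>2 / (2 * real p)"
    using p \<Delta> by (auto simp: \<epsilon>_def power_divide)
  have sep: "2 * \<sigma>\<^sup>2 * \<Delta>\<^sup>2 \<le> (\<Sum>j\<in>{1..p}. (?x r j - ?x l j)\<^sup>2)"
    if rl: "r < K" "l < K" "r \<noteq> l" for r l
  proof (cases "r div 2 = l div 2")
    case True
    have "even r \<noteq> even l"
    proof
      assume "even r = even l"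
      then have "r mod 2 = l mod 2"
        by (simp add: even_iff_mod_2_eq_zero) presburger
      with True have "r = l"
        by (metis div_mult_mod_eq)
      with rl(3) show False ..
    qed
    then have sgn: "(- 1) ^ r = - ((- 1) ^ l :: real)"
      by (auto simp: minus_one_power_iff)
    have "(?x r j - ?x l j)\<^sup>2 = 4 * \<sigma>\<^sup>2 * \<epsilon>\<^sup>2" if "j \<in> {1..p}" for j
    proof -
      have "v (l div 2) \<in> {1..p} \<rightarrow>\<^sub>E {- 1, 1}"
        using v rl by (intro PiE_mem[OF v]) auto
      then have "v (l div 2) j \<in> {- 1, 1}"
        using that by (rule PiE_mem)
      moreover have "?x r j - ?x l j = - 2 * (\<sigma> * \<epsilon>) * ((- 1) ^ l * v (l div 2) j)"
        by (simp add: pair_center_def True sgn)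
      moreover have "((- 1 :: real) ^ l)\<^sup>2 = 1"
        by (cases "even l") auto
      ultimately show ?thesis
        by (auto simp: power_mult_distrib)
    qed
    then have "(\<Sum>j\<in>{1..p}. (?x r j - ?x l j)\<^sup>2) = real p * (4 * \<sigma>\<^sup>2 * \<epsilon>\<^sup>2)"
      by simp
    also have "\<dots> = 2 * \<sigma>\<^sup>2 * \<Delta>\<^sup>2"
      using p by (simp add: \<epsilon>(2))
    finally show ?thesis by simp
  next
    case False
    have 1: "1 \<in> {1..p}" using p by simp
    have bd: "\<bar>\<sigma> * \<epsilon> * ((- 1) ^ r * v (r div 2) 1)\<bar> \<le> \<sigma> * \<epsilon>" if "r < K" for r
    proof -
      have "v (r div 2) \<in> {1..p} \<rightarrow>\<^sub>E {- 1, 1}"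
        using that by (intro PiE_mem[OF v]) auto
      then have "v (r div 2) 1 \<in> {- 1, 1}"
        using 1 by (rule PiE_mem)
      then show ?thesis
        using \<sigma> \<epsilon>(1) by (auto simp: abs_mult power_abs)
    qed
    have "1 \<le> \<bar>real (r div 2) - real (l div 2)\<bar>"
      using False by linarith
    then have "?R * 1 \<le> ?R * \<bar>real (r div 2) - real (l div 2)\<bar>"
      using \<sigma> \<epsilon>(1) \<Delta> by (intro mult_left_mono) auto
    also have "\<dots> = \<bar>?R * real (r div 2) - ?R * real (l div 2)\<bar>"
      using \<sigma> \<epsilon>(1) \<Delta> by (simp add: abs_mult flip: right_diff_distrib)
    finally have "2 * \<sigma> * \<Delta> \<le> \<bar>?x r 1 - ?x l 1\<bar>"
      using bd[OF rl(1)] bd[OF rl(2)] by (simp add: pair_center_def algebra_simps) linarith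
    then have "(2 * \<sigma> * \<Delta>)\<^sup>2 \<le> \<bar>?x r 1 - ?x l 1\<bar>\<^sup>2"
      using \<sigma> \<Delta> by (intro power_mono) auto
    also have "\<dots> \<le> (\<Sum>j\<in>{1..p}. (?x r j - ?x l j)\<^sup>2)"
      using 1 by (subst power2_abs) (intro member_le_sum, auto)
    finally have "4 * (\<sigma>\<^sup>2 * \<Delta>\<^sup>2) \<le> (\<Sum>j\<in>{1..p}. (?x r j - ?x l j)\<^sup>2)"
      by (simp add: power_mult_distrib)
    moreover have "0 \<le> \<sigma>\<^sup>2 * \<Delta>\<^sup>2" by simp
    ultimately show ?thesis
      unfolding mult.assoc by linarith
  qed
  have ge: "\<Delta>\<^sup>2 \<le> D" if "D \<in> ?D" for D
  proof -
    obtain l r where D: "D = (L2_set (\<lambda>j. centers K p ?x r j - centers K p ?x l j) {1..p})\<^sup>2 / (2 * \<sigma>\<^sup>2)"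
      and lr: "l \<in> {1..K}" "r \<in> {1..K}" "l \<noteq> r"
      using \<open>D \<in> ?D\<close> by blast
    have "(L2_set (\<lambda>j. centers K p ?x r j - centers K p ?x l j) {1..p})\<^sup>2
        = (\<Sum>j\<in>{1..p}. (centers K p ?x r j - centers K p ?x l j)\<^sup>2)"
      by (simp add: L2_set_def sum_nonneg)
    also have "\<dots> = (\<Sum>j\<in>{1..p}. (?x (r - 1) j - ?x (l - 1) j)\<^sup>2)"
      by (intro sum.cong refl) (use lr in \<open>simp add: centers_def\<close>)
    finally have D': "D = (\<Sum>j\<in>{1..p}. (?x (r - 1) j - ?x (l - 1) j)\<^sup>2) / (2 * \<sigma>\<^sup>2)"
      unfolding D by (rule arg_cong)
    have "r - 1 < K" "l - 1 < K" "r - 1 \<noteq> l - 1"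
      using lr by auto
    then have "\<Delta>\<^sup>2 * (2 * \<sigma>\<^sup>2) \<le> (\<Sum>j\<in>{1..p}. (?x (r - 1) j - ?x (l - 1) j)\<^sup>2)"
      by (subst mult.commute) (rule sep)
    then show ?thesis
      unfolding D' using \<sigma> by (subst pos_le_divide_eq) simp_all
  qed
  have "finite ?D"
  proof -
    have "?D \<subseteq> (\<lambda>(l, r). (L2_set (\<lambda>j. centers K p ?x r j - centers K p ?x l j) {1..p})\<^sup>2 / (2 * \<sigma>\<^sup>2))
        ` ({1..K} \<times> {1..K})"
      by auto
    then show ?thesis
      by (rule finite_subset) simp
  qed
  moreover have "?D \<noteq> {}"
  proof -
    have "1 \<in> {1..K}" "2 \<in> {1..K}" "(1::nat) \<noteq> 2" using K by auto
    then show ?thesis by blast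
  qed
  ultimately have "\<Delta>\<^sup>2 \<le> Min ?D"
    using ge by (intro Min.boundedI) auto
  then show ?thesis
    by (simp add: separated_means_def centers_def)
qed


section \<open>Indistinguishability of one swap\<close>

lemma cluster_law_centers:
  assumes "\<And>i. i \<in> {1..n} \<Longrightarrow> \<rho> i < K"
  shows "cluster_law n K p \<sigma> (centers K p x) (groups_by n K \<rho>)
    = gaussian_array {1..n} {1..p} \<sigma> (\<lambda>i. x (\<rho> i))"
  unfolding cluster_law_def gaussian_array_def isotropic_gaussian_def
proof (intro PiM_cong refl)
  fix i j assume ij: "i \<in> {1..n}" "j \<in> {1..p}"
  then have "group_of K (groups_by n K \<rho>) i = Suc (\<rho> i)" "\<rho> i < K"
    using assms by (auto intro: group_of_groups_by)
  then show "gaussian (centers K p x (group_of K (groups_by n K \<rho>) i) j) \<sigma> = gaussian (x (\<rho> i) j) \<sigma>"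
    using ij by (simp add: centers_def)
qed

lemma sum_PiE_slice:
  assumes "finite I" "b \<in> I"
  shows "(\<Sum>v\<in>I \<rightarrow>\<^sub>E S. F v) = (\<Sum>w\<in>(I - {b}) \<rightarrow>\<^sub>E S. \<Sum>s\<in>S. F (w(b := s)))"
proof -
  have "I \<rightarrow>\<^sub>E S = insert b (I - {b}) \<rightarrow>\<^sub>E S"
    using assms by (simp add: insert_absorb)
  also have "\<dots> = (\<lambda>(s, w). w(b := s)) ` (S \<times> ((I - {b}) \<rightarrow>\<^sub>E S))"
    by (rule PiE_insert_eq)
  finally have I: "I \<rightarrow>\<^sub>E S = (\<lambda>(s, w). w(b := s)) ` (S \<times> ((I - {b}) \<rightarrow>\<^sub>E S))" .
  have "inj_on (\<lambda>(s, w). w(b := s)) (S \<times> ((I - {b}) \<rightarrow>\<^sub>E S))"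
    using inj_combinator[of b "I - {b}" "\<lambda>_. S"] by simp
  then have "(\<Sum>v\<in>I \<rightarrow>\<^sub>E S. F v) = (\<Sum>(s, w)\<in>S \<times> ((I - {b}) \<rightarrow>\<^sub>E S). F (w(b := s)))"
    unfolding I by (simp add: sum.reindex case_prod_beta' comp_def)
  also have "\<dots> = (\<Sum>s\<in>S. \<Sum>w\<in>(I - {b}) \<rightarrow>\<^sub>E S. F (w(b := s)))"
    by (simp add: sum.cartesian_product)
  finally show ?thesis
    by (subst sum.swap)
qed

text \<open>
  Only the signs of the pair containing \<open>l\<close> are averaged out by \<open>sign_mixture_comparison\<close>; those of the
  other pairs are held fixed and absorbed into the baseline \<open>m\<close>, and the resulting inequalities are
  added up.
\<close>

lemma swap_comparison:
  fixes n K p :: nat and \<sigma> \<epsilon> R \<tau> :: real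
  assumes l: "l \<in> swap_sites n K" and \<sigma>: "\<sigma> > 0" and \<tau>: "\<tau> > 0" and n: "K \<le> n"
    and A: "A \<in> sets (\<Pi>\<^sub>M i\<in>{1..n}. \<Pi>\<^sub>M j\<in>{1..p}. borel)"
  defines "V \<equiv> {..<K} \<rightarrow>\<^sub>E sign_vectors {1..p}"
    and "P \<equiv> \<lambda>v \<rho>. gaussian_array {1..n} {1..p} \<sigma> (\<lambda>i. pair_center R (\<sigma> * \<epsilon>) v (\<rho> i))"
    and "B \<equiv> 1 + 4 * (1 - exp (- (2 * \<epsilon>\<^sup>2 * real n / real K))) * (exp (8 * \<epsilon>\<^sup>2) - 1)"
  shows "(\<Sum>v\<in>V. measure (P v (swapped_residue K l)) A)
    \<le> \<tau> / 2 * (\<Sum>v\<in>V. measure (P v (\<lambda>i. i mod K)) A) + real (card V) * B ^ p / (2 * \<tau>)"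
proof -
  note s = swap_sitesD[OF l]
  define b where "b = (l mod K) div 2"
  have K: "K > 0" and bK: "b < K"
    using s(4) by (auto simp: b_def)
  let ?S = "sign_vectors {1..p}"
  let ?W = "({..<K} - {b}) \<rightarrow>\<^sub>E ?S"
  \<comment> \<open>\<open>z\<close> says on which side of its pair an observation lies, and vanishes outside pair \<open>b\<close>.\<close>
  define z where "z i = (if (i mod K) div 2 = b then (- 1) ^ (i mod K) else 0 :: real)" for i
  define c where "c i = (if i \<in> {l, Suc l} then 0 else \<epsilon> * z i)" for i
  define d where "d i = (if i \<in> {l, Suc l} then \<epsilon> * z i else 0)" for i
  define m where "m w i j = (if j = 1 then R * real ((i mod K) div 2) else 0)
      + (if (i mod K) div 2 = b then 0 else \<sigma> * \<epsilon> * ((- 1) ^ (i mod K) * w ((i mod K) div 2) j))"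
    for w :: "nat \<Rightarrow> nat \<Rightarrow> real" and i j :: nat
  have pair: "(Suc l mod K) div 2 = b"
    using s(3) by (simp add: s(5) b_def)
  have zl: "z l = 1" "z (Suc l) = - 1"
    using s(3) by (simp_all add: z_def pair) (simp_all add: b_def s(5))
  have base: "pair_center R (\<sigma> * \<epsilon>) (w(b := s)) (i mod K) j = m w i j + \<sigma> * (s j * (c i + d i))" for w s i j
    by (auto simp: pair_center_def m_def c_def d_def z_def algebra_simps)
  have "m w l j = m w (Suc l) j" for w j
    by (simp add: m_def pair) (simp add: b_def)
  then have swapped: "pair_center R (\<sigma> * \<epsilon>) (w(b := s)) (swapped_residue K l i) j
      = m w i j + \<sigma> * (s j * (c i - d i))" for w s i j
    using base[of w s "Transposition.transpose l (Suc l) i" j] zl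
    by (cases "i = l \<or> i = Suc l") (auto simp: swapped_residue_def c_def d_def)
  define sc where "sc = (\<Sum>i\<in>{1..n}. (c i)\<^sup>2)"
  have orth: "(\<Sum>i\<in>{1..n}. c i * d i) = 0"
    by (intro sum.neutral) (auto simp: c_def d_def)
  have sd: "(\<Sum>i\<in>{1..n}. (d i)\<^sup>2) = 2 * \<epsilon>\<^sup>2"
  proof -
    have "(\<Sum>i\<in>{1..n}. (d i)\<^sup>2) = (\<Sum>i\<in>{l, Suc l}. (d i)\<^sup>2)"
      using s by (intro sum.mono_neutral_right) (auto simp: d_def)
    also have "\<dots> = 2 * \<epsilon>\<^sup>2"
      by (simp add: d_def zl power_mult_distrib)
    finally show ?thesis .
  qed
  have "sc \<le> 4 * \<epsilon>\<^sup>2 * real n / real K"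
  proof -
    let ?C = "{i \<in> {1..n}. (i mod K) div 2 = b}"
    have card_C: "real (card ?C) \<le> 4 * real n / real K"
    proof -
      have "?C \<subseteq> {i \<in> {1..n}. i mod K = l mod K} \<union> {i \<in> {1..n}. i mod K = Suc (l mod K)}"
        using s(3) by (auto simp: b_def elim!: evenE)
      then have "card ?C \<le> card ({i \<in> {1..n}. i mod K = l mod K} \<union> {i \<in> {1..n}. i mod K = Suc (l mod K)})"
        by (intro card_mono) auto
      also have "\<dots> \<le> card {i \<in> {1..n}. i mod K = l mod K} + card {i \<in> {1..n}. i mod K = Suc (l mod K)}"
        by (rule card_Un_le)
      also have "\<dots> \<le> Suc (n div K) + Suc (n div K)"
        using s(4) by (intro add_mono card_residue_class) auto
      finally have "real (card ?C) \<le> real (Suc (n div K) + Suc (n div K))"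
        by (rule of_nat_mono)
      then have "real (card ?C) \<le> 2 * (real (n div K) + 1)"
        by simp
      moreover have "1 \<le> real (n div K)"
        using n K by (simp add: Suc_le_eq div_greater_zero_iff)
      moreover have "real (n div K) \<le> real n / real K"
        by (rule of_nat_div_le_of_nat)
      ultimately have "real (card ?C) \<le> 4 * (real n / real K)"
        by argo
      then show ?thesis by simp
    qed
    have "sc \<le> (\<Sum>i\<in>{1..n}. if (i mod K) div 2 = b then \<epsilon>\<^sup>2 else 0)"
      unfolding sc_def by (intro sum_mono) (auto simp: c_def z_def power_mult_distrib minus_one_power_iff)
    also have "\<dots> = real (card ?C) * \<epsilon>\<^sup>2"
      by (simp add: sum.If_cases Int_def)
    also have "\<dots> \<le> 4 * real n / real K * \<epsilon>\<^sup>2"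
      by (intro mult_right_mono card_C) simp
    finally show ?thesis
      by (simp add: mult_ac)
  qed
  then have "1 - exp (- sc / 2) \<le> 1 - exp (- (2 * \<epsilon>\<^sup>2 * real n / real K))"
    by simp
  then have "4 * (1 - exp (- sc / 2)) * (exp (8 * \<epsilon>\<^sup>2) - 1)
      \<le> 4 * (1 - exp (- (2 * \<epsilon>\<^sup>2 * real n / real K))) * (exp (8 * \<epsilon>\<^sup>2) - 1)"
    by (intro mult_right_mono mult_left_mono) auto
  moreover have "0 \<le> 4 * (1 - exp (- sc / 2)) * (exp (8 * \<epsilon>\<^sup>2) - 1)"
    by (intro mult_nonneg_nonneg) (auto simp: sc_def sum_nonneg)
  ultimately have "(1 + 4 * (1 - exp (- sc / 2)) * (exp (8 * \<epsilon>\<^sup>2) - 1)) ^ p \<le> B ^ p"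
    unfolding B_def by (intro power_mono) auto
  then have B: "2 ^ p * (1 + 4 * (1 - exp (- sc / 2)) * (exp (4 * (2 * \<epsilon>\<^sup>2)) - 1)) ^ p / (2 * \<tau>)
      \<le> 2 ^ p * B ^ p / (2 * \<tau>)"
    using \<tau> by (intro divide_right_mono mult_left_mono) auto
  have slice: "(\<Sum>s\<in>?S. measure (P (w(b := s)) (swapped_residue K l)) A)
      \<le> \<tau> / 2 * (\<Sum>s\<in>?S. measure (P (w(b := s)) (\<lambda>i. i mod K)) A) + 2 ^ p * B ^ p / (2 * \<tau>)" for w
  proof -
    have "(\<Sum>s\<in>?S. measure (P (w(b := s)) (swapped_residue K l)) A)
      \<le> \<tau> / 2 * (\<Sum>s\<in>?S. measure (P (w(b := s)) (\<lambda>i. i mod K)) A)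
        + 2 ^ card {1..p} * (1 + 4 * (1 - exp (- sc / 2)) * (exp (4 * (2 * \<epsilon>\<^sup>2)) - 1)) ^ card {1..p} / (2 * \<tau>)"
      unfolding P_def base swapped sc_def sd[symmetric]
      by (intro sign_mixture_comparison[OF _ _ \<sigma> \<tau> A orth]) auto
    then show ?thesis
      using B by simp
  qed
  have card_S: "card ?S = 2 ^ p"
    by (simp add: card_PiE numeral_2_eq_2)
  have "card V = card ?W * card ?S"
    using sum_PiE_slice[of "{..<K}" b "\<lambda>_. 1 :: nat" ?S] bK by (simp add: V_def)
  then have card_V: "real (card V) = real (card ?W) * 2 ^ p"
    by (simp only: card_S of_nat_mult of_nat_power of_nat_numeral)
  have "(\<Sum>v\<in>V. measure (P v (swapped_residue K l)) A)
      = (\<Sum>w\<in>?W. \<Sum>s\<in>?S. measure (P (w(b := s)) (swapped_residue K l)) A)"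
    unfolding V_def using bK by (intro sum_PiE_slice) auto
  also have "\<dots> \<le> (\<Sum>w\<in>?W. \<tau> / 2 * (\<Sum>s\<in>?S. measure (P (w(b := s)) (\<lambda>i. i mod K)) A) + 2 ^ p * B ^ p / (2 * \<tau>))"
    by (intro sum_mono slice)
  also have "\<dots> = \<tau> / 2 * (\<Sum>w\<in>?W. \<Sum>s\<in>?S. measure (P (w(b := s)) (\<lambda>i. i mod K)) A)
      + real (card V) * B ^ p / (2 * \<tau>)"
    unfolding sum.distrib sum_distrib_left[symmetric] sum_constant card_V by simp
  also have "(\<Sum>w\<in>?W. \<Sum>s\<in>?S. measure (P (w(b := s)) (\<lambda>i. i mod K)) A) = (\<Sum>v\<in>V. measure (P v (\<lambda>i. i mod K)) A)"
    unfolding V_def using bK by (intro sum_PiE_slice[symmetric]) auto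
  finally show ?thesis .
qed

text \<open>
  The factor \<open>1 - exp (- u)\<close>, with \<open>u = 2\<epsilon>\<^sup>2n/K\<close>, measures how well the rest of the pair reveals the sign
  in one coordinate.  If the logarithm attains the maximum, bounding this factor by \<open>1\<close> suffices.
  Otherwise \<open>pK / n\<close> exceeds \<open>ln n\<close>, hence \<open>8\<epsilon>\<^sup>2 \<le> 1\<close>; then the exponential can be linearised and the
  bound \<open>u\<close> is the efficient one.
\<close>

lemma second_moment_le_sqrt:
  fixes n K p :: nat and \<Delta> :: real
  assumes "n \<ge> 2" "K \<ge> 1" "K \<le> n" "p \<ge> 1"
    and le: "\<Delta>\<^sup>2 \<le> 1 / 32 * max (ln (real n)) (sqrt (real p * real K * ln (real n) / real n))"
    and \<epsilon>: "\<epsilon>\<^sup>2 = \<Delta>\<^sup>2 / (2 * real p)"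
  shows "(1 + 4 * (1 - exp (- (2 * \<epsilon>\<^sup>2 * real n / real K))) * (exp (8 * \<epsilon>\<^sup>2) - 1)) ^ p \<le> sqrt (real n)"
proof -
  let ?L = "ln (real n)" and ?x = "real p * real K * ln (real n) / real n"
  let ?u = "2 * \<epsilon>\<^sup>2 * real n / real K" and ?w = "8 * \<epsilon>\<^sup>2"
  have L: "?L > 0" using assms by simp
  have sqrt_n: "sqrt (real n) = exp (?L / 2)"
    using assms by (simp add: ln_sqrt[symmetric] real_sqrt_gt_zero)
  have u: "0 \<le> ?u" and w: "0 \<le> ?w" by auto
  have fac: "0 \<le> 1 - exp (- ?u)" "1 - exp (- ?u) \<le> 1" "1 - exp (- ?u) \<le> ?u" "0 \<le> exp ?w - 1"
    using u w exp_ge_add_one_self[of "- ?u"] by auto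
  have pos: "0 \<le> 1 + 4 * (1 - exp (- ?u)) * (exp ?w - 1)"
    using fac by (intro add_nonneg_nonneg mult_nonneg_nonneg) auto
  have reduce: ?thesis
    if y: "1 + 4 * (1 - exp (- ?u)) * (exp ?w - 1) \<le> exp y" and yL: "real p * y \<le> ?L / 2" for y
  proof -
    have "(1 + 4 * (1 - exp (- ?u)) * (exp ?w - 1)) ^ p \<le> exp y ^ p"
      by (intro power_mono y pos)
    also have "\<dots> = exp (real p * y)"
      by (simp add: exp_of_nat_mult)
    also have "\<dots> \<le> exp (?L / 2)"
      using yL by simp
    finally show ?thesis by (simp only: sqrt_n)
  qed
  show ?thesis
  proof (cases "sqrt ?x \<le> ?L")
    case True
    show ?thesis
    proof (rule reduce)
      have "4 * (1 - exp (- ?u)) * (exp ?w - 1) \<le> 4 * 1 * (exp ?w - 1)"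
        using fac by (intro mult_right_mono mult_left_mono) auto
      moreover have "1 + real 4 * (exp ?w - 1) \<le> (1 + (exp ?w - 1)) ^ 4"
        using fac(4) by (intro Bernoulli_inequality) linarith
      moreover have "(1 + (exp ?w - 1)) ^ 4 = exp (4 * ?w)"
        using exp_of_nat_mult[of 4 ?w] by simp
      ultimately show "1 + 4 * (1 - exp (- ?u)) * (exp ?w - 1) \<le> exp (4 * ?w)"
        by simp
      have "real p * (4 * ?w) = 16 * \<Delta>\<^sup>2"
        using assms(4) by (simp add: \<epsilon>)
      also have "\<dots> \<le> 16 * (1 / 32 * ?L)"
        using le True by (simp add: max_absorb1)
      finally show "real p * (4 * ?w) \<le> ?L / 2" by simp
    qed
  next
    case False
    then have D: "\<Delta>\<^sup>2 \<le> 1 / 32 * sqrt ?x" and gt: "?L < sqrt ?x"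
      using le by (simp_all add: max_absorb2)
    have x: "0 < ?x" "(sqrt ?x)\<^sup>2 = ?x"
      using assms L by auto
    have "sqrt ?x * ?L \<le> sqrt ?x * sqrt ?x"
      using gt x(1) by (intro mult_left_mono) auto
    also have "\<dots> = real p * real K / real n * ?L"
      using x(2) by (simp add: power2_eq_square)
    finally have "sqrt ?x \<le> real p * real K / real n"
      using L by (rule mult_right_le_imp_le)
    also have "\<dots> \<le> real p"
      using assms by (simp add: divide_le_eq)
    finally have "\<Delta>\<^sup>2 \<le> 1 / 32 * real p"
      using D by linarith
    then have w1: "?w \<le> 1"
      using assms(4) by (simp add: \<epsilon> field_simps)
    show ?thesis
    proof (rule reduce)
      have "exp ?w \<le> 1 + ?w + ?w\<^sup>2"
        using w w1 by (rule exp_bound)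
      moreover have "?w\<^sup>2 \<le> ?w"
        using mult_left_mono[OF w1 w] by (simp add: power2_eq_square)
      ultimately have "exp ?w - 1 \<le> 2 * ?w" by linarith
      then have "4 * (1 - exp (- ?u)) * (exp ?w - 1) \<le> 4 * ?u * (2 * ?w)"
        using fac u by (intro mult_mono) auto
      then have "1 + 4 * (1 - exp (- ?u)) * (exp ?w - 1) \<le> 1 + 4 * ?u * (2 * ?w)"
        by simp
      also have "\<dots> \<le> exp (4 * ?u * (2 * ?w))"
        by (rule exp_ge_add_one_self)
      finally show "1 + 4 * (1 - exp (- ?u)) * (exp ?w - 1) \<le> exp (4 * ?u * (2 * ?w))" .
      have "\<Delta>\<^sup>2 = 2 * real p * \<epsilon>\<^sup>2"
        using assms(4) by (simp add: \<epsilon>)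
      then have "real p * (4 * ?u * (2 * ?w)) = 32 * real n / (real K * real p) * (\<Delta>\<^sup>2)\<^sup>2"
        using assms(2,4) by (simp only:) (simp add: field_simps power2_eq_square)
      also have "\<dots> \<le> 32 * real n / (real K * real p) * (1 / 32 * sqrt ?x)\<^sup>2"
        using D by (intro mult_left_mono power_mono) auto
      also have "\<dots> = 32 * real n / (real K * real p) * (?x / 1024)"
        by (simp only: power_mult_distrib x(2)) (simp add: power2_eq_square)
      also have "\<dots> = ?L / 32"
        using assms(1,2,4) by (simp add: field_simps)
      also have "\<dots> \<le> ?L / 2"
        using L by simp
      finally show "real p * (4 * ?u * (2 * ?w)) \<le> ?L / 2" .
    qed
  qed
qed

section \<open>The lower bound\<close>

text \<open>
  The threshold \<open>576 = 24\<^sup>2\<close> is where \<open>\<surd>n\<close>, the bound on the second moment, reaches \<open>n/24\<close>, a quarter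
  of the guaranteed number \<open>n/6\<close> of swaps.
\<close>

theorem theorem4:
  "\<exists>c C n\<^sub>0 :: real. c > 0 \<and> C > 0 \<and> n\<^sub>0 > 0 \<and>
     (\<forall>(n::nat) (K::nat) (p::nat) (\<alpha>::real) (\<sigma>::real) (\<Delta>::real).
        K \<ge> 2 \<longrightarrow> real n \<ge> 9 * real K / 2 \<longrightarrow> \<alpha> \<ge> 3 / 2 \<longrightarrow> real n \<ge> n\<^sub>0 \<longrightarrow>
        p \<ge> 1 \<longrightarrow> \<sigma> > 0 \<longrightarrow> \<Delta> > 0 \<longrightarrow>
        \<Delta>\<^sup>2 \<le> c * max (ln (real n)) (sqrt (real p * real K * ln (real n) / real n)) \<longrightarrow>
        (\<forall>Ghat \<in> estimators n K p.
           (SUP G \<in> balanced_partitions n K \<alpha>. SUP \<mu> \<in> separated_means K p \<sigma> \<Delta>.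
              emeasure (cluster_law n K p \<sigma> \<mu> G)
                {Y \<in> space (cluster_law n K p \<sigma> \<mu> G). Ghat Y \<noteq> G ` {1..K}}) > ennreal C))"
proof (intro exI conjI allI impI ballI)
  show "(1 / 32 :: real) > 0" "(1 / 4 :: real) > 0" "(576 :: real) > 0"
    by simp_all
  fix n K p :: nat and \<alpha> \<sigma> \<Delta> :: real and Ghat
  assume K: "K \<ge> 2" and nK: "real n \<ge> 9 * real K / 2" and \<alpha>: "\<alpha> \<ge> 3 / 2" and n: "real n \<ge> 576"
    and p: "p \<ge> 1" and \<sigma>: "\<sigma> > 0" and \<Delta>: "\<Delta> > 0"
    and \<Delta>_le: "\<Delta>\<^sup>2 \<le> 1 / 32 * max (ln (real n)) (sqrt (real p * real K * ln (real n) / real n))"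
    and Ghat: "Ghat \<in> estimators n K p"
  let ?risk = "\<lambda>G \<mu>. emeasure (cluster_law n K p \<sigma> \<mu> G)
                {Y \<in> space (cluster_law n K p \<sigma> \<mu> G). Ghat Y \<noteq> G ` {1..K}}"
  have n4: "4 * K \<le> n" "9 * K \<le> 2 * n" "K \<le> n" "n \<ge> 2"
    using nK K by linarith+
  define \<epsilon> where "\<epsilon> = \<Delta> / sqrt (2 * real p)"
  define R where "R = 2 * \<sigma> * (\<epsilon> + \<Delta>)"
  have \<epsilon>: "\<epsilon>\<^sup>2 = \<Delta>\<^sup>2 / (2 * real p)"
    using p by (simp add: \<epsilon>_def power_divide)
  define V where "V = {..<K} \<rightarrow>\<^sub>E sign_vectors {1..p}"
  define P where "P v \<rho> = gaussian_array {1..n} {1..p} \<sigma> (\<lambda>i. pair_center R (\<sigma> * \<epsilon>) v (\<rho> i))" for v \<rho>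
  define G where "G l = groups_by n K (swapped_residue K l)" for l
  let ?L = "swap_sites n K"
  define M where "M = real (card ?L)"
  \<comment> \<open>The common sample space, and the event that the partition swapped at \<open>l\<close> is recovered.\<close>
  define \<Omega> where "\<Omega> = ({1..n} \<rightarrow>\<^sub>E ({1..p} \<rightarrow>\<^sub>E (UNIV :: real set)))"
  define A where "A l = {Y \<in> \<Omega>. Ghat Y = G l ` {1..K}}" for l
  define B where "B = (1 + 4 * (1 - exp (- (2 * \<epsilon>\<^sup>2 * real n / real K))) * (exp (8 * \<epsilon>\<^sup>2) - 1)) ^ p"
  have finV: "finite V"
    unfolding V_def by (intro finite_PiE) auto
  have "V \<noteq> {}"
    by (auto simp: V_def PiE_eq_empty_iff)
  then have cardV: "real (card V) > 0"
    using finV by (simp add: card_gt_0_iff)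
  have M: "M \<ge> real n / 6"
    unfolding M_def using K n4 by (intro card_swap_sites)
  then have Mpos: "M > 0" using n by linarith
  have prob: "prob_space (P v \<rho>)" for v \<rho>
    unfolding P_def by (rule prob_space_gaussian_array[OF \<sigma>])
  have sp: "space (P v \<rho>) = \<Omega>" for v \<rho>
    by (simp add: P_def space_gaussian_array \<Omega>_def)
  have law: "cluster_law n K p \<sigma> (centers K p (pair_center R (\<sigma> * \<epsilon>) v)) (G l) = P v (swapped_residue K l)" for v l
    unfolding P_def G_def using K by (intro cluster_law_centers) (simp add: swapped_residue_def)
  have A_sets: "A l \<in> sets (\<Pi>\<^sub>M i\<in>{1..n}. \<Pi>\<^sub>M j\<in>{1..p}. borel)" for l
  proof -
    let ?N = "\<Pi>\<^sub>M i\<in>{1..n}. \<Pi>\<^sub>M j\<in>{1..p}. (borel :: real measure)"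
    let ?T = "{Q. partition_on {1..n} Q \<and> card Q = K}"
    have m: "Ghat \<in> measurable ?N (count_space ?T)"
      using Ghat by (simp add: estimators_def)
    have "Ghat -` ({G l ` {1..K}} \<inter> ?T) \<inter> space ?N \<in> sets ?N"
      by (rule measurable_sets[OF m]) auto
    also have "Ghat -` ({G l ` {1..K}} \<inter> ?T) \<inter> space ?N = A l"
      using measurable_space[OF m] by (auto simp: A_def \<Omega>_def space_PiM)
    finally show ?thesis .
  qed
  then have A_P: "A l \<in> sets (P v \<rho>)" for l v \<rho>
    by (simp add: P_def sets_gaussian_array)
  have disj: "disjoint_family_on A ?L"
    unfolding disjoint_family_on_def A_def G_def
    using groups_by_swapped_distinct[OF n4(1)] by auto
  show "ennreal (1 / 4) < (SUP G \<in> balanced_partitions n K \<alpha>. SUP \<mu> \<in> separated_means K p \<sigma> \<Delta>. ?risk G \<mu>)"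
  proof (rule ccontr)
    assume "\<not> ?thesis"
    then have small: "?risk G' \<mu> \<le> ennreal (1 / 4)"
      if "G' \<in> balanced_partitions n K \<alpha>" "\<mu> \<in> separated_means K p \<sigma> \<Delta>" for G' \<mu>
      using that by (simp add: not_less SUP_le_iff)
    have success: "3 / 4 \<le> measure (P v (swapped_residue K l)) (A l)" if l: "l \<in> ?L" and v: "v \<in> V" for l v
    proof -
      interpret prob_space "P v (swapped_residue K l)" by (rule prob)
      note s = swap_sitesD[OF l]
      have "G l \<in> balanced_partitions n K \<alpha>"
        unfolding G_def using K s n4 \<alpha> by (intro groups_by_swapped_balanced) auto
      moreover have "centers K p (pair_center R (\<sigma> * \<epsilon>) v) \<in> separated_means K p \<sigma> \<Delta>"
        unfolding R_def \<epsilon>_def using v unfolding V_def by (intro pair_centers_separated K p \<sigma> \<Delta>)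
      ultimately have "?risk (G l) (centers K p (pair_center R (\<sigma> * \<epsilon>) v)) \<le> ennreal (1 / 4)"
        by (rule small)
      then have "emeasure (P v (swapped_residue K l)) {Y \<in> \<Omega>. Ghat Y \<noteq> G l ` {1..K}} \<le> ennreal (1 / 4)"
        unfolding law sp .
      moreover have "{Y \<in> \<Omega>. Ghat Y \<noteq> G l ` {1..K}} = space (P v (swapped_residue K l)) - A l"
        by (auto simp: sp A_def)
      ultimately have "measure (P v (swapped_residue K l)) (space (P v (swapped_residue K l)) - A l) \<le> 1 / 4"
        by (simp add: emeasure_eq_measure)
      then show ?thesis
        using prob_compl[OF A_P] by simp
    qed
    have "M * real (card V) * (3 / 4) = (\<Sum>l\<in>?L. \<Sum>v\<in>V. 3 / 4)"
      by (simp add: M_def)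
    also have "\<dots> \<le> (\<Sum>l\<in>?L. \<Sum>v\<in>V. measure (P v (swapped_residue K l)) (A l))"
      by (intro sum_mono success)
    also have "\<dots> \<le> (\<Sum>l\<in>?L. (M / 2) / 2 * (\<Sum>v\<in>V. measure (P v (\<lambda>i. i mod K)) (A l))
        + real (card V) * B / (2 * (M / 2)))"
      unfolding P_def V_def B_def using Mpos n4(3)
      by (intro sum_mono swap_comparison \<sigma> A_sets) auto
    also have "\<dots> = M / 4 * (\<Sum>l\<in>?L. \<Sum>v\<in>V. measure (P v (\<lambda>i. i mod K)) (A l))
        + M * (real (card V) * B / (2 * (M / 2)))"
      by (simp only: sum.distrib sum_constant M_def flip: sum_distrib_left)
    also have "M * (real (card V) * B / (2 * (M / 2))) = real (card V) * B"
      using Mpos by simp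
    also have "(\<Sum>l\<in>?L. \<Sum>v\<in>V. measure (P v (\<lambda>i. i mod K)) (A l))
        = (\<Sum>v\<in>V. \<Sum>l\<in>?L. measure (P v (\<lambda>i. i mod K)) (A l))"
      by (rule sum.swap)
    also have "(\<Sum>v\<in>V. \<Sum>l\<in>?L. measure (P v (\<lambda>i. i mod K)) (A l)) \<le> (\<Sum>v\<in>V. 1)"
    proof (rule sum_mono)
      fix v
      interpret prob_space "P v (\<lambda>i. i mod K)" by (rule prob)
      have "(\<Sum>l\<in>?L. prob (A l)) = prob (\<Union>l\<in>?L. A l)"
        using A_P disj by (intro finite_measure_finite_Union[symmetric]) auto
      then show "(\<Sum>l\<in>?L. prob (A l)) \<le> 1" by simp
    qed
    finally have "M * real (card V) * (3 / 4) \<le> M / 4 * real (card V) + real (card V) * B"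
      using Mpos by (simp add: mult_left_mono)
    then have "real (card V) * (M / 2) \<le> real (card V) * B"
      by (simp add: algebra_simps)
    then have "M / 2 \<le> B"
      using cardV by simp
    also have "B \<le> sqrt (real n)"
      unfolding B_def using K n4 p by (intro second_moment_le_sqrt[OF _ _ _ _ \<Delta>_le \<epsilon>]) auto
    finally have "real n / 12 \<le> sqrt (real n)"
      using M by linarith
    then have "sqrt (real n) * sqrt (real n) \<le> 12 * sqrt (real n)"
      by simp
    moreover have "sqrt (real n) \<ge> sqrt 576"
      using n by (rule real_sqrt_le_mono)
    moreover have "sqrt 576 = (24 :: real)"
      by (rule real_sqrt_unique) auto
    ultimately have "0 < sqrt (real n)" "\<not> sqrt (real n) \<le> 12"
      by linarith+
    with \<open>sqrt (real n) * sqrt (real n) \<le> 12 * sqrt (real n)\<close> show False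
      using mult_right_le_imp_le by blast
  qed
qed

end
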